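(* Let $k$ be an algebraically closed field, let $(\mathcal{T},\mathcal{T}^p,\mathbb{S},\mathcal{S})$ be an SMC quadruple over $k$, and let $X$ and $Y$ be objects of $\mathcal{T}$. (a) For every choice of truncation triangles and connecting morphisms for $X$, the direct system $$\mathcal{T}(Y,X)\to\mathcal{T}(Y,X_{\leq 0})\to\mathcal{T}(Y,X_{\leq -1})\to\cdots\to\mathcal{T}(Y,X_{\leq -p})\to\cdots$$ (obtained by applying $\mathcal{T}(Y,-)$ to $X\xrightarrow{g_0}X_{\leq 0}\xrightarrow{\xi_0}X_{\leq -1}\xrightarrow{\xi_{-1}}\cdots$) stabilizes for $p\gg 0$, i.e. $\mathcal{T}(Y,X_{\leq -p})\to\mathcal{T}(Y,X_{\leq -p-1})$ is an isomorphism for all sufficiently large $p$. Moreover, $$\varinjlim_{p}\,\mathcal{T}(Y,X_{\leq -p})\cong(\mathcal{T}/\mathcal{T}^p)(Y,X).$$ (b) Fixing truncation triangles (and connecting morphisms) for $X$ and $Y$, we have $$\varprojlim_{q}\Big(\varinjlim_{p}\,\mathcal{T}(Y_{\leq -q},\Sigma X_{>-p})\Big)\cong(\mathcal{T}/\mathcal{T}^p)(Y,X),$$ where the direct system in $p$ is induced by the morphisms $\Sigma\alpha_{-p}:\Sigma X_{>-p}\to\Sigma X_{>-p-1}$ and the inverse system in $q$ is induced by precomposition with the morphisms $\xi_{-q}:Y_{\leq -q}\to Y_{\leq -q-1}$.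
   Context: Conventions. $\mathcal{T}(X,Y)$ denotes the Hom-space in $\mathcal{T}$, $\Sigma$ is the suspension, $D=\mathrm{Hom}_k(-,k)$. The superscript $p$ in $\mathcal{T}^p$ is part of the name of the subcategory and is unrelated to the integer index $p$. For a subcategory (or collection of objects) $\mathcal{X}$ of $\mathcal{T}$: $\mathcal{X}^\perp=\{T\mid\mathcal{T}(\mathcal{X},T)=0\}$, ${}^\perp\mathcal{X}=\{T\mid\mathcal{T}(T,\mathcal{X})=0\}$. $\mathcal{X}*\mathcal{Y}$ is the full subcategory of objects $T$ fitting in a triangle $X\to T\to Y\to\Sigma X$ with $X\in\mathcal{X}$, $Y\in\mathcal{Y}$; if $\mathcal{T}(\mathcal{X},\mathcal{Y})=0$ it is written $\mathcal{X}\perp\mathcal{Y}$. $\Sigma^{\geq 0}\mathcal{S}$ means $\{\Sigma^m S\mid m\geq 0,\ S\in\mathcal{S}\}$, and similarly for $\Sigma^{<0}\mathcal{S}$ etc. A torsion pair is a pair $(\mathcal{A},\mathcal{B})$ of full subcategories closed under direct summands with $\mathcal{T}=\mathcal{A}\perp\mathcal{B}$; a co-$t$-structure is a torsion pair with $\Sigma^{-1}\mathcal{A}\subseteq\mathcal{A}$ (equivalently $\Sigma\mathcal{B}\subseteq\mathcal{B}$). Simple minded collection (SMC). In a $k$-linear, Hom-finite, Krull-Schmidt triangulated category $\mathcal{T}$, a collection $\mathcal{S}$ is an SMC if for all $X,Y\in\mathcal{S}$: $\mathcal{T}(X,\Sigma^{m}Y)=0$ for all $m<0$; $\dim_k\mathcal{T}(X,Y)=\delta_{XY}$;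 and $\mathrm{thick}(\mathcal{S})=\mathcal{T}$. SMC quadruple $(\mathcal{T},\mathcal{T}^p,\mathbb{S},\mathcal{S})$: (RS0) $\mathcal{T}$ is a $k$-linear, Hom-finite, Krull-Schmidt triangulated category and $\mathcal{T}^p$ is a thick subcategory of $\mathcal{T}$; (RS1) $\mathbb{S}:\mathcal{T}\to\mathcal{T}$ is a triangle equivalence restricting to an equivalence $\mathcal{T}^p\to\mathcal{T}^p$, with a bifunctorial isomorphism $D\mathcal{T}(X,Y)\cong\mathcal{T}(Y,\mathbb{S}X)$ for $X\in\mathcal{T}^p$, $Y\in\mathcal{T}$; (RS2) $\mathcal{S}$ is an SMC in $\mathcal{T}$, and $\mathcal{T}={}^\perp(\Sigma^{\geq 0}\mathcal{S})\perp{}^\perp(\Sigma^{<0}\mathcal{S})=(\Sigma^{\geq 0}\mathcal{S})^\perp\perp(\Sigma^{<0}\mathcal{S})^\perp$ are co-$t$-structures on $\mathcal{T}$ with ${}^\perp(\Sigma^{\geq 0}\mathcal{S})\subset\mathcal{T}^p$ and $(\Sigma^{<0}\mathcal{S})^\perp\subset\mathcal{T}^p$. $\mathcal{T}/\mathcal{T}^p$ denotes the Verdier quotient, which has the same objects as $\mathcal{T}$. Truncations. For $i\in\mathbb{Z}$ put $\mathcal{T}_{>i}={}^\perp(\Sigma^{>-i-1}\mathcal{S})$ and $\mathcal{T}_{\leq i}={}^\perp(\Sigma^{<-i}\mathcal{S})$. Then $(\mathcal{T}_{>i},\mathcal{T}_{\leq i})$ is a co-$t$-structure, so each $X\in\mathcal{T}$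 has a (non-unique) truncation triangle $X_{>i}\xrightarrow{f_i}X\xrightarrow{g_i}X_{\leq i}\to\Sigma X_{>i}$ with $X_{>i}\in\mathcal{T}_{>i}$, $X_{\leq i}\in\mathcal{T}_{\leq i}$; $X_{>i}$ and $X_{\leq i}$ denote objects in a chosen such triangle. Given chosen truncation triangles, the connecting morphisms $\alpha_i:X_{>i}\to X_{>i-1}$ and $\xi_i:X_{\leq i}\to X_{\leq i-1}$ are morphisms such that $(\alpha_i,\mathrm{id}_X,\xi_i)$ is a morphism from the truncation triangle at $i$ to the one at $i-1$; in particular $f_{i-1}\alpha_i=f_i$ and $\xi_i g_i=g_{i-1}$ (such morphisms exist but are not unique). They give a direct system $X\xrightarrow{g_0}X_{\leq 0}\xrightarrow{\xi_0}X_{\leq -1}\xrightarrow{\xi_{-1}}X_{\leq -2}\to\cdots$. *)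

theory Defs
  imports "HOL-Algebra.Algebra"
begin

text \<open>Free the identifier \<open>X\<close>, which HOL-Algebra uses for the polynomial indeterminate.\<close>

no_notation var (\<open>X\<index>\<close>)

section \<open>Vector spaces\<close>

text \<open>
  A vector space over a field \<open>K\<close> is a module record \<open>V\<close> with \<open>module K V\<close>.  Module records extend ring
  records, but the locale \<open>module\<close> ignores the fields \<open>mult\<close> and \<open>one\<close>; they are left undefined below.
\<close>

definition lin_map :: "('k, 'r) ring_scheme \<Rightarrow> ('k, 'v, 's) module_scheme \<Rightarrow> ('k, 'w, 't) module_scheme
    \<Rightarrow> ('v \<Rightarrow> 'w) \<Rightarrow> bool" where
  "lin_map K V W \<phi> \<longleftrightarrow> \<phi> \<in> carrier V \<rightarrow> carrier W \<and>
    (\<forall>x\<in>carrier V. \<forall>y\<in>carrier V. \<phi> (x \<oplus>\<^bsub>V\<^esub> y) = \<phi> x \<oplus>\<^bsub>W\<^esub> \<phi> y) \<and>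
    (\<forall>c\<in>carrier K. \<forall>x\<in>carrier V. \<phi> (c \<odot>\<^bsub>V\<^esub> x) = c \<odot>\<^bsub>W\<^esub> \<phi> x)"

definition lin_iso :: "('k, 'r) ring_scheme \<Rightarrow> ('k, 'v, 's) module_scheme \<Rightarrow> ('k, 'w, 't) module_scheme
    \<Rightarrow> ('v \<Rightarrow> 'w) \<Rightarrow> bool" where
  "lin_iso K V W \<phi> \<longleftrightarrow> lin_map K V W \<phi> \<and> bij_betw \<phi> (carrier V) (carrier W)"

definition lin_isomorphic :: "('k, 'r) ring_scheme \<Rightarrow> ('k, 'v, 's) module_scheme
    \<Rightarrow> ('k, 'w, 't) module_scheme \<Rightarrow> bool" where
  "lin_isomorphic K V W \<longleftrightarrow> (\<exists>\<phi>. lin_iso K V W \<phi>)"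

definition has_dim :: "('k, 'r) ring_scheme \<Rightarrow> ('k, 'v, 's) module_scheme \<Rightarrow> nat \<Rightarrow> bool" where
  "has_dim K V n \<longleftrightarrow> (\<exists>B. finite B \<and> card B = n \<and> B \<subseteq> carrier V \<and>
    (\<forall>v\<in>carrier V. \<exists>!c. c \<in> B \<rightarrow>\<^sub>E carrier K \<and> v = finsum V (\<lambda>b. c b \<odot>\<^bsub>V\<^esub> b) B))"

definition dual :: "('k, 'r) ring_scheme \<Rightarrow> ('k, 'v, 's) module_scheme \<Rightarrow> ('k, 'v \<Rightarrow> 'k) module" where
  "dual K V = \<lparr>carrier = {\<phi> \<in> carrier V \<rightarrow>\<^sub>E carrier K.
        (\<forall>x\<in>carrier V. \<forall>y\<in>carrier V. \<phi> (x \<oplus>\<^bsub>V\<^esub> y) = \<phi> x \<oplus>\<^bsub>K\<^esub> \<phi> y) \<and>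
        (\<forall>c\<in>carrier K. \<forall>x\<in>carrier V. \<phi> (c \<odot>\<^bsub>V\<^esub> x) = c \<otimes>\<^bsub>K\<^esub> \<phi> x)},
     monoid.mult = undefined, one = undefined,
     ring.zero = (\<lambda>v\<in>carrier V. \<zero>\<^bsub>K\<^esub>),
     ring.add = (\<lambda>\<phi> \<psi>. \<lambda>v\<in>carrier V. \<phi> v \<oplus>\<^bsub>K\<^esub> \<psi> v),
     module.smult = (\<lambda>c \<phi>. \<lambda>v\<in>carrier V. c \<otimes>\<^bsub>K\<^esub> \<phi> v)\<rparr>"

subsection \<open>Direct and inverse limits of sequences\<close>

text \<open>A direct system is given by \<open>V n\<close> and transition maps \<open>t n\<close> from \<open>V n\<close> to \<open>V (Suc n)\<close>.\<close>

fun dl_push :: "(nat \<Rightarrow> 'v \<Rightarrow> 'v) \<Rightarrow> nat \<Rightarrow> nat \<Rightarrow> 'v \<Rightarrow> 'v" where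
  "dl_push t n 0 v = v"
| "dl_push t n (Suc j) v = t (n + j) (dl_push t n j v)"

definition dl_rel :: "(nat \<Rightarrow> ('k, 'v, 's) module_scheme) \<Rightarrow> (nat \<Rightarrow> 'v \<Rightarrow> 'v)
    \<Rightarrow> ((nat \<times> 'v) \<times> (nat \<times> 'v)) set" where
  "dl_rel V t = {((n, v), (m, w)). v \<in> carrier (V n) \<and> w \<in> carrier (V m) \<and>
     (\<exists>i j. n + i = m + j \<and> dl_push t n i v = dl_push t m j w)}"

definition dlim :: "(nat \<Rightarrow> ('k, 'v, 's) module_scheme) \<Rightarrow> (nat \<Rightarrow> 'v \<Rightarrow> 'v)
    \<Rightarrow> ('k, (nat \<times> 'v) set) module" where
  "dlim V t = \<lparr>carrier = (SIGMA n:UNIV. carrier (V n)) // dl_rel V t,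
     monoid.mult = undefined, one = undefined,
     ring.zero = dl_rel V t `` {(0, \<zero>\<^bsub>V 0\<^esub>)},
     ring.add = (\<lambda>A B. \<Union>(n, v)\<in>A. \<Union>(m, w)\<in>B. dl_rel V t ``
        {(n + m, dl_push t n m v \<oplus>\<^bsub>V (n + m)\<^esub> dl_push t m n w)}),
     module.smult = (\<lambda>c A. \<Union>(n, v)\<in>A. dl_rel V t `` {(n, c \<odot>\<^bsub>V n\<^esub> v)})\<rparr>"

text \<open>The map into \<open>dlim V t\<close> induced by a levelwise morphism \<open>\<phi>\<close> of direct systems.\<close>

definition dlim_map :: "(nat \<Rightarrow> ('k, 'v, 's) module_scheme) \<Rightarrow> (nat \<Rightarrow> 'v \<Rightarrow> 'v)
    \<Rightarrow> (nat \<Rightarrow> 'u \<Rightarrow> 'v) \<Rightarrow> (nat \<times> 'u) set \<Rightarrow> (nat \<times> 'v) set" where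
  "dlim_map V t \<phi> A = (\<Union>(n, v)\<in>A. dl_rel V t `` {(n, \<phi> n v)})"

text \<open>An inverse system is given by \<open>V n\<close> and transition maps \<open>t n\<close> from \<open>V (Suc n)\<close> to \<open>V n\<close>.\<close>

definition invlim :: "(nat \<Rightarrow> ('k, 'v, 's) module_scheme) \<Rightarrow> (nat \<Rightarrow> 'v \<Rightarrow> 'v)
    \<Rightarrow> ('k, nat \<Rightarrow> 'v) module" where
  "invlim V t = \<lparr>carrier = {x. \<forall>n. x n \<in> carrier (V n) \<and> t n (x (Suc n)) = x n},
     monoid.mult = undefined, one = undefined,
     ring.zero = (\<lambda>n. \<zero>\<^bsub>V n\<^esub>),
     ring.add = (\<lambda>x y n. x n \<oplus>\<^bsub>V n\<^esub> y n),
     module.smult = (\<lambda>c x n. c \<odot>\<^bsub>V n\<^esub> x n)\<rparr>"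

section \<open>Linear categories\<close>

text \<open>
  The objects are the elements of the type \<open>'o\<close>.  \<open>g \<cdot>\<^bsub>T\<^esub> f\<close> is \<open>f\<close> followed by \<open>g\<close>.
\<close>

record ('k, 'o, 'm) lcat =
  Hom :: "'o \<Rightarrow> 'o \<Rightarrow> ('k, 'm) module"
  Cmp :: "'m \<Rightarrow> 'm \<Rightarrow> 'm"  (infixl \<open>\<cdot>\<index>\<close> 70)
  Idt :: "'o \<Rightarrow> 'm"

abbreviation homs :: "('k, 'o, 'm, 'z) lcat_scheme \<Rightarrow> 'o \<Rightarrow> 'o \<Rightarrow> 'm set" where
  "homs T X Y \<equiv> carrier (Hom T X Y)"

locale linear_category =
  fixes K :: "('k, 'r) ring_scheme" and T :: "('k, 'o, 'm, 'z) lcat_scheme"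
  assumes field_K: "field K"
    and module_Hom: "module K (Hom T X Y)"
    and homs_disjoint: "f \<in> homs T X Y \<Longrightarrow> f \<in> homs T X' Y' \<Longrightarrow> X = X' \<and> Y = Y'"
    and Idt_closed: "Idt T X \<in> homs T X X"
    and Cmp_closed: "f \<in> homs T X Y \<Longrightarrow> g \<in> homs T Y Z \<Longrightarrow> g \<cdot>\<^bsub>T\<^esub> f \<in> homs T X Z"
    and Cmp_Idt_left: "f \<in> homs T X Y \<Longrightarrow> Idt T Y \<cdot>\<^bsub>T\<^esub> f = f"
    and Cmp_Idt_right: "f \<in> homs T X Y \<Longrightarrow> f \<cdot>\<^bsub>T\<^esub> Idt T X = f"
    and Cmp_assoc: "f \<in> homs T W X \<Longrightarrow> g \<in> homs T X Y \<Longrightarrow> h \<in> homs T Y Z \<Longrightarrow>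
      (h \<cdot>\<^bsub>T\<^esub> g) \<cdot>\<^bsub>T\<^esub> f = h \<cdot>\<^bsub>T\<^esub> (g \<cdot>\<^bsub>T\<^esub> f)"
    and Cmp_lin_left: "f \<in> homs T X Y \<Longrightarrow> lin_map K (Hom T Y Z) (Hom T X Z) (\<lambda>g. g \<cdot>\<^bsub>T\<^esub> f)"
    and Cmp_lin_right: "g \<in> homs T Y Z \<Longrightarrow> lin_map K (Hom T X Y) (Hom T X Z) (\<lambda>f. g \<cdot>\<^bsub>T\<^esub> f)"

definition is_iso :: "('k, 'o, 'm, 'z) lcat_scheme \<Rightarrow> 'o \<Rightarrow> 'o \<Rightarrow> 'm \<Rightarrow> bool" where
  "is_iso T X Y f \<longleftrightarrow> f \<in> homs T X Y \<and>
    (\<exists>g\<in>homs T Y X. g \<cdot>\<^bsub>T\<^esub> f = Idt T X \<and> f \<cdot>\<^bsub>T\<^esub> g = Idt T Y)"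

definition isomorphic :: "('k, 'o, 'm, 'z) lcat_scheme \<Rightarrow> 'o \<Rightarrow> 'o \<Rightarrow> bool" where
  "isomorphic T X Y \<longleftrightarrow> (\<exists>f. is_iso T X Y f)"

definition zero_object :: "('k, 'o, 'm, 'z) lcat_scheme \<Rightarrow> 'o \<Rightarrow> bool" where
  "zero_object T X \<longleftrightarrow>
    (\<forall>Y. homs T X Y = {\<zero>\<^bsub>Hom T X Y\<^esub>} \<and> homs T Y X = {\<zero>\<^bsub>Hom T Y X\<^esub>})"

text \<open>\<open>Y\<close> is the direct sum of the objects \<open>Xs a\<close> for \<open>a < n\<close>, expressed through biproduct equations.\<close>

definition direct_sum :: "('k, 'o, 'm, 'z) lcat_scheme \<Rightarrow> nat \<Rightarrow> (nat \<Rightarrow> 'o) \<Rightarrow> 'o \<Rightarrow> bool" where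
  "direct_sum T n Xs Y \<longleftrightarrow> (\<exists>i p.
    (\<forall>a<n. i a \<in> homs T (Xs a) Y \<and> p a \<in> homs T Y (Xs a)) \<and>
    (\<forall>a<n. \<forall>b<n. p b \<cdot>\<^bsub>T\<^esub> i a = (if a = b then Idt T (Xs a) else \<zero>\<^bsub>Hom T (Xs a) (Xs b)\<^esub>)) \<and>
    finsum (Hom T Y Y) (\<lambda>a. i a \<cdot>\<^bsub>T\<^esub> p a) {..<n} = Idt T Y)"

definition direct_sum2 :: "('k, 'o, 'm, 'z) lcat_scheme \<Rightarrow> 'o \<Rightarrow> 'o \<Rightarrow> 'o \<Rightarrow> bool" where
  "direct_sum2 T X X' Y \<longleftrightarrow> direct_sum T 2 (\<lambda>a. if a = 0 then X else X') Y"

definition closed_under_summands :: "('k, 'o, 'm, 'z) lcat_scheme \<Rightarrow> 'o set \<Rightarrow> bool" where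
  "closed_under_summands T U \<longleftrightarrow> (\<forall>X X' Y. direct_sum2 T X X' Y \<and> Y \<in> U \<longrightarrow> X \<in> U)"

definition Hom_finite :: "('k, 'r) ring_scheme \<Rightarrow> ('k, 'o, 'm, 'z) lcat_scheme \<Rightarrow> bool" where
  "Hom_finite K T \<longleftrightarrow> (\<forall>X Y. \<exists>n. has_dim K (Hom T X Y) n)"

text \<open>The endomorphism ring is local: it is nonzero and its non-units are closed under addition.\<close>

definition local_End :: "('k, 'o, 'm, 'z) lcat_scheme \<Rightarrow> 'o \<Rightarrow> bool" where
  "local_End T X \<longleftrightarrow> Idt T X \<noteq> \<zero>\<^bsub>Hom T X X\<^esub> \<and>
    (\<forall>f\<in>homs T X X. \<forall>g\<in>homs T X X. \<not> is_iso T X X f \<and> \<not> is_iso T X X g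
      \<longrightarrow> \<not> is_iso T X X (f \<oplus>\<^bsub>Hom T X X\<^esub> g))"

definition Krull_Schmidt :: "('k, 'o, 'm, 'z) lcat_scheme \<Rightarrow> bool" where
  "Krull_Schmidt T \<longleftrightarrow> (\<forall>Y. \<exists>n Xs. direct_sum T n Xs Y \<and> (\<forall>a<n. local_End T (Xs a)))"

subsection \<open>Functors\<close>

text \<open>An endofunctor is given by its action \<open>F\<close> on objects and its action \<open>Fm\<close> on morphisms.\<close>

definition additive_functor :: "('k, 'o, 'm, 'z) lcat_scheme \<Rightarrow> ('o \<Rightarrow> 'o) \<Rightarrow> ('m \<Rightarrow> 'm) \<Rightarrow> bool" where
  "additive_functor T F Fm \<longleftrightarrow>
    (\<forall>X Y. \<forall>f\<in>homs T X Y. Fm f \<in> homs T (F X) (F Y)) \<and>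
    (\<forall>X. Fm (Idt T X) = Idt T (F X)) \<and>
    (\<forall>X Y Z. \<forall>f\<in>homs T X Y. \<forall>g\<in>homs T Y Z. Fm (g \<cdot>\<^bsub>T\<^esub> f) = Fm g \<cdot>\<^bsub>T\<^esub> Fm f) \<and>
    (\<forall>X Y. \<forall>f\<in>homs T X Y. \<forall>g\<in>homs T X Y.
      Fm (f \<oplus>\<^bsub>Hom T X Y\<^esub> g) = Fm f \<oplus>\<^bsub>Hom T (F X) (F Y)\<^esub> Fm g)"

text \<open>The functor restricts to an equivalence from the full subcategory on \<open>U\<close> to itself.\<close>

definition equivalence_on :: "('k, 'o, 'm, 'z) lcat_scheme \<Rightarrow> 'o set \<Rightarrow> ('o \<Rightarrow> 'o) \<Rightarrow> ('m \<Rightarrow> 'm) \<Rightarrow> bool" where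
  "equivalence_on T U F Fm \<longleftrightarrow> F ` U \<subseteq> U \<and>
    (\<forall>X\<in>U. \<forall>Y\<in>U. bij_betw Fm (homs T X Y) (homs T (F X) (F Y))) \<and>
    (\<forall>Y\<in>U. \<exists>X\<in>U. isomorphic T (F X) Y)"

section \<open>Triangulated categories\<close>

text \<open>
  \<open>Susp\<close> and \<open>SuspM\<close> give the suspension functor on objects and morphisms.  A tuple
  \<open>(X, Y, Z, f, g, h)\<close> in \<open>Tri\<close> is a distinguished triangle with maps \<open>f\<close> from \<open>X\<close> to \<open>Y\<close>, \<open>g\<close> from \<open>Y\<close> to \<open>Z\<close>
  and \<open>h\<close> from \<open>Z\<close> to \<open>Susp X\<close>.
\<close>

record ('k, 'o, 'm) tcat = "('k, 'o, 'm) lcat" +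
  Susp :: "'o \<Rightarrow> 'o"
  SuspM :: "'m \<Rightarrow> 'm"
  Tri :: "('o \<times> 'o \<times> 'o \<times> 'm \<times> 'm \<times> 'm) set"

definition candidate_triangle :: "('k, 'o, 'm, 'z) tcat_scheme
    \<Rightarrow> 'o \<times> 'o \<times> 'o \<times> 'm \<times> 'm \<times> 'm \<Rightarrow> bool" where
  "candidate_triangle T = (\<lambda>(X, Y, Z, f, g, h).
    f \<in> homs T X Y \<and> g \<in> homs T Y Z \<and> h \<in> homs T Z (Susp T X))"

definition triangle_morphism :: "('k, 'o, 'm, 'z) tcat_scheme \<Rightarrow> 'o \<times> 'o \<times> 'o \<times> 'm \<times> 'm \<times> 'm
    \<Rightarrow> 'o \<times> 'o \<times> 'o \<times> 'm \<times> 'm \<times> 'm \<Rightarrow> 'm \<Rightarrow> 'm \<Rightarrow> 'm \<Rightarrow> bool" where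
  "triangle_morphism T = (\<lambda>(X, Y, Z, f, g, h) (X', Y', Z', f', g', h') a b c.
    a \<in> homs T X X' \<and> b \<in> homs T Y Y' \<and> c \<in> homs T Z Z' \<and>
    b \<cdot>\<^bsub>T\<^esub> f = f' \<cdot>\<^bsub>T\<^esub> a \<and> c \<cdot>\<^bsub>T\<^esub> g = g' \<cdot>\<^bsub>T\<^esub> b \<and> SuspM T a \<cdot>\<^bsub>T\<^esub> h = h' \<cdot>\<^bsub>T\<^esub> c)"

text \<open>The suspension is only required to be an autoequivalence, not an automorphism.\<close>

locale triangulated_category = linear_category K T
  for K :: "('k, 'r) ring_scheme" and T :: "('k, 'o, 'm, 'z) tcat_scheme" +
  assumes zero_object_exists: "\<exists>Z. zero_object T Z"
    and direct_sum2_exists: "\<exists>Y. direct_sum2 T X X' Y"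
    and Susp_functor: "additive_functor T (Susp T) (SuspM T)"
    and Susp_linear: "lin_map K (Hom T X Y) (Hom T (Susp T X) (Susp T Y)) (SuspM T)"
    and Susp_equivalence: "equivalence_on T UNIV (Susp T) (SuspM T)"
    and Tri_candidate: "t \<in> Tri T \<Longrightarrow> candidate_triangle T t"
    and Tri_iso: "(X, Y, Z, f, g, h) \<in> Tri T \<Longrightarrow> candidate_triangle T (X', Y', Z', f', g', h') \<Longrightarrow>
      triangle_morphism T (X, Y, Z, f, g, h) (X', Y', Z', f', g', h') a b c \<Longrightarrow>
      is_iso T X X' a \<Longrightarrow> is_iso T Y Y' b \<Longrightarrow> is_iso T Z Z' c \<Longrightarrow>
      (X', Y', Z', f', g', h') \<in> Tri T"
    and Tri_Idt: "zero_object T Z \<Longrightarrow>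
      (X, X, Z, Idt T X, \<zero>\<^bsub>Hom T X Z\<^esub>, \<zero>\<^bsub>Hom T Z (Susp T X)\<^esub>) \<in> Tri T"
    and Tri_cone: "f \<in> homs T X Y \<Longrightarrow> \<exists>Z g h. (X, Y, Z, f, g, h) \<in> Tri T"
    and Tri_rotate: "candidate_triangle T (X, Y, Z, f, g, h) \<Longrightarrow>
      (X, Y, Z, f, g, h) \<in> Tri T \<longleftrightarrow>
      (Y, Z, Susp T X, g, h, \<ominus>\<^bsub>Hom T (Susp T X) (Susp T Y)\<^esub> (SuspM T f)) \<in> Tri T"
    and Tri_fill: "(X, Y, Z, f, g, h) \<in> Tri T \<Longrightarrow> (X', Y', Z', f', g', h') \<in> Tri T \<Longrightarrow>
      a \<in> homs T X X' \<Longrightarrow> b \<in> homs T Y Y' \<Longrightarrow> b \<cdot>\<^bsub>T\<^esub> f = f' \<cdot>\<^bsub>T\<^esub> a \<Longrightarrow>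
      \<exists>c. triangle_morphism T (X, Y, Z, f, g, h) (X', Y', Z', f', g', h') a b c"
    and octahedral: "(X, Y, Z', f, i, i') \<in> Tri T \<Longrightarrow> (Y, Z, X', g, j, j') \<in> Tri T \<Longrightarrow>
      (X, Z, Y', g \<cdot>\<^bsub>T\<^esub> f, k, k') \<in> Tri T \<Longrightarrow>
      \<exists>u v. (Z', Y', X', u, v, SuspM T i \<cdot>\<^bsub>T\<^esub> j') \<in> Tri T \<and>
        u \<cdot>\<^bsub>T\<^esub> i = k \<cdot>\<^bsub>T\<^esub> g \<and> k' \<cdot>\<^bsub>T\<^esub> u = i' \<and> v \<cdot>\<^bsub>T\<^esub> k = j \<and> j' \<cdot>\<^bsub>T\<^esub> v = SuspM T f \<cdot>\<^bsub>T\<^esub> k'"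

text \<open>A chosen desuspension; it is determined up to isomorphism since the suspension is an equivalence.\<close>

definition desusp :: "('k, 'o, 'm, 'z) tcat_scheme \<Rightarrow> 'o \<Rightarrow> 'o" where
  "desusp T X = (SOME Z. isomorphic T (Susp T Z) X)"

definition shift :: "('k, 'o, 'm, 'z) tcat_scheme \<Rightarrow> int \<Rightarrow> 'o \<Rightarrow> 'o" where
  "shift T m X = (if 0 \<le> m then (Susp T ^^ nat m) X else (desusp T ^^ nat (- m)) X)"

definition shifts :: "('k, 'o, 'm, 'z) tcat_scheme \<Rightarrow> int set \<Rightarrow> 'o set \<Rightarrow> 'o set" where
  "shifts T M U = {shift T m X | m X. m \<in> M \<and> X \<in> U}"

definition right_perp :: "('k, 'o, 'm, 'z) lcat_scheme \<Rightarrow> 'o set \<Rightarrow> 'o set" where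
  "right_perp T U = {Y. \<forall>X\<in>U. homs T X Y = {\<zero>\<^bsub>Hom T X Y\<^esub>}}"

definition left_perp :: "('k, 'o, 'm, 'z) lcat_scheme \<Rightarrow> 'o set \<Rightarrow> 'o set" where
  "left_perp T U = {Y. \<forall>X\<in>U. homs T Y X = {\<zero>\<^bsub>Hom T Y X\<^esub>}}"

definition star :: "('k, 'o, 'm, 'z) tcat_scheme \<Rightarrow> 'o set \<Rightarrow> 'o set \<Rightarrow> 'o set" where
  "star T A B = {Y. \<exists>X\<in>A. \<exists>Z\<in>B. \<exists>f g h. (X, Y, Z, f, g, h) \<in> Tri T}"

definition torsion_pair :: "('k, 'o, 'm, 'z) tcat_scheme \<Rightarrow> 'o set \<Rightarrow> 'o set \<Rightarrow> bool" where
  "torsion_pair T A B \<longleftrightarrow> closed_under_summands T A \<and> closed_under_summands T B \<and>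
    (\<forall>X\<in>A. \<forall>Y\<in>B. homs T X Y = {\<zero>\<^bsub>Hom T X Y\<^esub>}) \<and> star T A B = UNIV"

definition co_t_structure :: "('k, 'o, 'm, 'z) tcat_scheme \<Rightarrow> 'o set \<Rightarrow> 'o set \<Rightarrow> bool" where
  "co_t_structure T A B \<longleftrightarrow> torsion_pair T A B \<and> shifts T {-1} A \<subseteq> A"

definition thick_subcategory :: "('k, 'o, 'm, 'z) tcat_scheme \<Rightarrow> 'o set \<Rightarrow> bool" where
  "thick_subcategory T U \<longleftrightarrow> (\<forall>Z. zero_object T Z \<longrightarrow> Z \<in> U) \<and>
    (\<forall>X. X \<in> U \<longleftrightarrow> Susp T X \<in> U) \<and>
    (\<forall>X Y Z f g h. (X, Y, Z, f, g, h) \<in> Tri T \<and> X \<in> U \<and> Y \<in> U \<longrightarrow> Z \<in> U) \<and>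
    closed_under_summands T U"

text \<open>
  A triangle functor commutes with the suspension up to a natural isomorphism \<open>\<theta>\<close>, which enters the
  third map of the image of a triangle.
\<close>

definition triangle_functor :: "('k, 'o, 'm, 'z) tcat_scheme \<Rightarrow> ('o \<Rightarrow> 'o) \<Rightarrow> ('m \<Rightarrow> 'm) \<Rightarrow> bool" where
  "triangle_functor T F Fm \<longleftrightarrow> additive_functor T F Fm \<and> (\<exists>\<theta>.
    (\<forall>X. is_iso T (F (Susp T X)) (Susp T (F X)) (\<theta> X)) \<and>
    (\<forall>X Y. \<forall>f\<in>homs T X Y. \<theta> Y \<cdot>\<^bsub>T\<^esub> Fm (SuspM T f) = SuspM T (Fm f) \<cdot>\<^bsub>T\<^esub> \<theta> X) \<and>
    (\<forall>X Y Z f g h. (X, Y, Z, f, g, h) \<in> Tri T \<longrightarrow>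
      (F X, F Y, F Z, Fm f, Fm g, \<theta> X \<cdot>\<^bsub>T\<^esub> Fm h) \<in> Tri T))"

subsection \<open>Verdier quotient\<close>

text \<open>
  A morphism from \<open>Y\<close> to \<open>X\<close> in the quotient of \<open>T\<close> by \<open>U\<close> is a class of roofs \<open>(Z, s, f)\<close> with \<open>s\<close> from \<open>Z\<close> to \<open>Y\<close>,
  \<open>f\<close> from \<open>Z\<close> to \<open>X\<close> and the cone of \<open>s\<close> in \<open>U\<close>; such a roof represents \<open>f \<cdot> s\<^sup>-\<^sup>1\<close>.  Sums are computed on a
  common denominator, composites by completing \<open>f\<close> and \<open>s'\<close> to a commutative square.
\<close>

definition quot_mors :: "('k, 'o, 'm, 'z) tcat_scheme \<Rightarrow> 'o set \<Rightarrow> 'o \<Rightarrow> 'o \<Rightarrow> 'm set" where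
  "quot_mors T U X Y = {s. \<exists>C\<in>U. \<exists>g h. (X, Y, C, s, g, h) \<in> Tri T}"

definition roofs :: "('k, 'o, 'm, 'z) tcat_scheme \<Rightarrow> 'o set \<Rightarrow> 'o \<Rightarrow> 'o \<Rightarrow> ('o \<times> 'm \<times> 'm) set" where
  "roofs T U Y X = {(Z, s, f). s \<in> quot_mors T U Z Y \<and> f \<in> homs T Z X}"

definition roof_rel :: "('k, 'o, 'm, 'z) tcat_scheme \<Rightarrow> 'o set \<Rightarrow> 'o \<Rightarrow> 'o
    \<Rightarrow> (('o \<times> 'm \<times> 'm) \<times> ('o \<times> 'm \<times> 'm)) set" where
  "roof_rel T U Y X = {((Z, s, f), (Z', s', f')).
     (Z, s, f) \<in> roofs T U Y X \<and> (Z', s', f') \<in> roofs T U Y X \<and>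
     (\<exists>W. \<exists>a\<in>homs T W Z. \<exists>b\<in>homs T W Z'. s \<cdot>\<^bsub>T\<^esub> a \<in> quot_mors T U W Y \<and>
        s \<cdot>\<^bsub>T\<^esub> a = s' \<cdot>\<^bsub>T\<^esub> b \<and> f \<cdot>\<^bsub>T\<^esub> a = f' \<cdot>\<^bsub>T\<^esub> b)}"

definition quot_Hom :: "('k, 'o, 'm, 'z) tcat_scheme \<Rightarrow> 'o set \<Rightarrow> 'o \<Rightarrow> 'o
    \<Rightarrow> ('k, ('o \<times> 'm \<times> 'm) set) module" where
  "quot_Hom T U Y X = \<lparr>carrier = roofs T U Y X // roof_rel T U Y X,
     monoid.mult = undefined, one = undefined,
     ring.zero = roof_rel T U Y X `` {(Y, Idt T Y, \<zero>\<^bsub>Hom T Y X\<^esub>)},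
     ring.add = (\<lambda>A B. \<Union>{roof_rel T U Y X `` {(Z, s, f \<oplus>\<^bsub>Hom T Z X\<^esub> g)} | Z s f g.
        (Z, s, f) \<in> A \<and> (Z, s, g) \<in> B}),
     module.smult = (\<lambda>c A. \<Union>(Z, s, f)\<in>A. roof_rel T U Y X `` {(Z, s, c \<odot>\<^bsub>Hom T Z X\<^esub> f)})\<rparr>"

definition verdier_quotient :: "('k, 'o, 'm, 'z) tcat_scheme \<Rightarrow> 'o set
    \<Rightarrow> ('k, 'o, ('o \<times> 'm \<times> 'm) set) lcat" where
  "verdier_quotient T U = \<lparr>Hom = quot_Hom T U,
     Cmp = (\<lambda>B A. \<Union>{roof_rel T U X Z `` {(V, s \<cdot>\<^bsub>T\<^esub> a, f' \<cdot>\<^bsub>T\<^esub> b)} | X Y Z W W' V s f s' f' a b.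
        (W, s, f) \<in> A \<and> (W', s', f') \<in> B \<and>
        (W, s, f) \<in> roofs T U X Y \<and> (W', s', f') \<in> roofs T U Y Z \<and>
        a \<in> quot_mors T U V W \<and> b \<in> homs T V W' \<and> f \<cdot>\<^bsub>T\<^esub> a = s' \<cdot>\<^bsub>T\<^esub> b}),
     Idt = (\<lambda>X. roof_rel T U X X `` {(X, Idt T X, Idt T X)})\<rparr>"

section \<open>Simple minded collections and SMC quadruples\<close>

definition SMC :: "('k, 'r) ring_scheme \<Rightarrow> ('k, 'o, 'm, 'z) tcat_scheme \<Rightarrow> 'o set \<Rightarrow> bool" where
  "SMC K T S \<longleftrightarrow>
    (\<forall>X\<in>S. \<forall>Y\<in>S. \<forall>m<0. homs T X (shift T m Y) = {\<zero>\<^bsub>Hom T X (shift T m Y)\<^esub>}) \<and>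
    (\<forall>X\<in>S. \<forall>Y\<in>S. has_dim K (Hom T X Y) (if X = Y then 1 else 0)) \<and>
    thick_subcategory T hull S = UNIV"

text \<open>
  Bifunctorial isomorphisms from the dual of \<open>Hom T X Y\<close> to \<open>Hom T Y (F X)\<close>, for \<open>X\<close> in \<open>P\<close> and \<open>Y\<close> in \<open>T\<close>.
\<close>

definition relative_Serre_duality :: "('k, 'r) ring_scheme \<Rightarrow> ('k, 'o, 'm, 'z) lcat_scheme
    \<Rightarrow> 'o set \<Rightarrow> ('o \<Rightarrow> 'o) \<Rightarrow> ('m \<Rightarrow> 'm) \<Rightarrow> bool" where
  "relative_Serre_duality K T P F Fm \<longleftrightarrow> (\<exists>\<eta>.
    (\<forall>X\<in>P. \<forall>Y. lin_iso K (dual K (Hom T X Y)) (Hom T Y (F X)) (\<eta> X Y)) \<and>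
    (\<forall>X\<in>P. \<forall>X'\<in>P. \<forall>Y Y'. \<forall>a\<in>homs T X X'. \<forall>b\<in>homs T Y' Y.
      \<forall>\<phi>\<in>carrier (dual K (Hom T X Y)).
        \<eta> X' Y' (\<lambda>u\<in>homs T X' Y'. \<phi> (b \<cdot>\<^bsub>T\<^esub> u \<cdot>\<^bsub>T\<^esub> a)) = Fm a \<cdot>\<^bsub>T\<^esub> \<eta> X Y \<phi> \<cdot>\<^bsub>T\<^esub> b))"

locale SMC_quadruple = triangulated_category K T
  for K :: "('k, 'r) ring_scheme" and T :: "('k, 'o, 'm, 'z) tcat_scheme"
    and Tp :: "'o set" and SS :: "'o \<Rightarrow> 'o" and SSm :: "'m \<Rightarrow> 'm" and S :: "'o set" +
  assumes RS0_Hom_finite: "Hom_finite K T"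
    and RS0_Krull_Schmidt: "Krull_Schmidt T"
    and RS0_thick: "thick_subcategory T Tp"
    and RS1_triangle_functor: "triangle_functor T SS SSm"
    and RS1_equivalence: "equivalence_on T UNIV SS SSm"
    and RS1_restricts: "equivalence_on T Tp SS SSm"
    and RS1_duality: "relative_Serre_duality K T Tp SS SSm"
    and RS2_SMC: "SMC K T S"
    and RS2_left: "co_t_structure T (left_perp T (shifts T {0..} S)) (left_perp T (shifts T {..<0} S))"
    and RS2_right: "co_t_structure T (right_perp T (shifts T {0..} S)) (right_perp T (shifts T {..<0} S))"
    and RS2_left_sub: "left_perp T (shifts T {0..} S) \<subseteq> Tp"
    and RS2_right_sub: "right_perp T (shifts T {..<0} S) \<subseteq> Tp"

subsection \<open>Truncations\<close>

definition T_gt :: "('k, 'o, 'm, 'z) tcat_scheme \<Rightarrow> 'o set \<Rightarrow> int \<Rightarrow> 'o set" where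
  "T_gt T S i = left_perp T (shifts T {- i - 1<..} S)"

definition T_le :: "('k, 'o, 'm, 'z) tcat_scheme \<Rightarrow> 'o set \<Rightarrow> int \<Rightarrow> 'o set" where
  "T_le T S i = left_perp T (shifts T {..<- i} S)"

text \<open>
  A choice of truncation triangles of an object for all integers, together with connecting morphisms
  \<open>tr_alpha i\<close> from \<open>tr_gt i\<close> to \<open>tr_gt (i - 1)\<close> and \<open>tr_xi i\<close> from \<open>tr_le i\<close> to \<open>tr_le (i - 1)\<close>.
\<close>

record ('o, 'm) truncation =
  tr_gt :: "int \<Rightarrow> 'o"
  tr_le :: "int \<Rightarrow> 'o"
  tr_f :: "int \<Rightarrow> 'm"
  tr_g :: "int \<Rightarrow> 'm"
  tr_h :: "int \<Rightarrow> 'm"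
  tr_alpha :: "int \<Rightarrow> 'm"
  tr_xi :: "int \<Rightarrow> 'm"

definition tr_triangle :: "'o \<Rightarrow> ('o, 'm) truncation \<Rightarrow> int \<Rightarrow> 'o \<times> 'o \<times> 'o \<times> 'm \<times> 'm \<times> 'm" where
  "tr_triangle X R i = (tr_gt R i, X, tr_le R i, tr_f R i, tr_g R i, tr_h R i)"

definition is_truncation :: "('k, 'o, 'm, 'z) tcat_scheme \<Rightarrow> 'o set \<Rightarrow> 'o \<Rightarrow> ('o, 'm) truncation \<Rightarrow> bool" where
  "is_truncation T S X R \<longleftrightarrow> (\<forall>i. tr_gt R i \<in> T_gt T S i \<and> tr_le R i \<in> T_le T S i \<and>
    tr_triangle X R i \<in> Tri T \<and>
    triangle_morphism T (tr_triangle X R i) (tr_triangle X R (i - 1)) (tr_alpha R i) (Idt T X) (tr_xi R i))"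

subsection \<open>The direct and inverse systems\<close>

definition colim_le :: "('k, 'o, 'm, 'z) tcat_scheme \<Rightarrow> 'o \<Rightarrow> ('o, 'm) truncation
    \<Rightarrow> ('k, (nat \<times> 'm) set) module" where
  "colim_le T Y R = dlim (\<lambda>p. Hom T Y (tr_le R (- int p))) (\<lambda>p u. tr_xi R (- int p) \<cdot>\<^bsub>T\<^esub> u)"

definition gt_sys :: "('k, 'o, 'm, 'z) tcat_scheme \<Rightarrow> 'o \<Rightarrow> ('o, 'm) truncation
    \<Rightarrow> nat \<Rightarrow> ('k, 'm) module" where
  "gt_sys T W R p = Hom T W (Susp T (tr_gt R (- int p)))"

definition gt_trans :: "('k, 'o, 'm, 'z) tcat_scheme \<Rightarrow> ('o, 'm) truncation \<Rightarrow> nat \<Rightarrow> 'm \<Rightarrow> 'm" where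
  "gt_trans T R p u = SuspM T (tr_alpha R (- int p)) \<cdot>\<^bsub>T\<^esub> u"

text \<open>
  For truncations \<open>Q\<close> of \<open>Y\<close> and \<open>R\<close> of \<open>X\<close>, the inverse limit over \<open>q\<close> of the direct limits over \<open>p\<close> of
  the spaces of morphisms from \<open>tr_le Q (- q)\<close> to the suspension of \<open>tr_gt R (- p)\<close>.
\<close>

definition lim_colim :: "('k, 'o, 'm, 'z) tcat_scheme \<Rightarrow> ('o, 'm) truncation \<Rightarrow> ('o, 'm) truncation
    \<Rightarrow> ('k, nat \<Rightarrow> (nat \<times> 'm) set) module" where
  "lim_colim T Q R = invlim
     (\<lambda>q. dlim (gt_sys T (tr_le Q (- int q)) R) (gt_trans T R))
     (\<lambda>q. dlim_map (gt_sys T (tr_le Q (- int q)) R) (gt_trans T R)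
        (\<lambda>p u. u \<cdot>\<^bsub>T\<^esub> tr_xi Q (- int q)))"

end

theory Submission
  imports Defs
begin

text \<open>
  Write \<open>le p\<close> and \<open>gt p\<close> for the two truncations of \<open>X\<close> at \<open>- p\<close>, and \<open>g p\<close>, \<open>h p\<close> for the maps from \<open>X\<close> to
  \<open>le p\<close> and from \<open>le p\<close> to the suspension of \<open>gt p\<close>.  Objects of \<open>Tp\<close> are called perfect.  All the work is
  in vanishing statements, which say that \<open>le p\<close> moves away from every fixed object as \<open>p\<close> grows.

  The basic one is \<open>orth_T_le_left\<close>: for every object \<open>W\<close> there is an \<open>i\<close> such that no object of \<open>T_le T S i\<close> has
  nonzero maps to \<open>W\<close>.  The objects \<open>W\<close> with this property form a thick subcategory that contains \<open>S\<close>, and \<open>S\<close>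
  generates.  Relative Serre duality turns it around: a perfect object has no maps to objects of \<open>T_le T S i\<close> for
  small \<open>i\<close> (\<open>orth_perfect_left\<close>), and a fixed object has no maps to perfect objects of \<open>T_le T S i\<close> for small \<open>i\<close>
  (\<open>orth_perfect_right\<close>).

  The connecting map from \<open>le p\<close> to \<open>le (Suc p)\<close> has a perfect cone in \<open>T_le T S (- int p)\<close>, so that it is bijective
  on maps out of \<open>Y\<close> for large \<open>p\<close>.  This is the stabilization.

  A map with perfect cone induces a bijection on maps to \<open>le p\<close> for large \<open>p\<close> (\<open>quot_mors_eventually_iso\<close>).
  Hence for a roof formed by \<open>s\<close> from \<open>Z\<close> to \<open>Y\<close> and \<open>a\<close> from \<open>Z\<close> to \<open>X\<close>, the map \<open>g p \<bullet> a\<close> extends along \<open>s\<close> to a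
  map \<open>u\<close> from \<open>Y\<close> to \<open>le p\<close>, uniquely in the direct limit.  Conversely \<open>u\<close> lifts to a roof by pulling it back
  along \<open>g p\<close>, whose cone, the suspension of \<open>gt p\<close>, is perfect.  So the equation \<open>u \<bullet> s = g p \<bullet> a\<close> identifies the
  direct limit with the Hom-space of the Verdier quotient (\<open>lin_iso_roof_class\<close>).

  For the iterated limit, let \<open>W\<close> be a truncation of \<open>Y\<close> so far out that neither it nor its suspension has maps
  to the suspension of \<open>X\<close>.  Composition with \<open>h p\<close> then identifies maps from \<open>W\<close> to \<open>le p\<close> with maps from \<open>W\<close>
  to the suspension of \<open>gt p\<close>.  The map from \<open>Y\<close> to \<open>W\<close> and the connecting maps between the truncations of \<open>Y\<close>
  have perfect cones, so that all maps in the inverse system far out are bijective and its limit is the direct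
  limit of the first part.
\<close>

section \<open>Linear maps and duals\<close>

lemma lin_mapI:
  assumes "\<And>x. x \<in> carrier V \<Longrightarrow> \<phi> x \<in> carrier W"
    and "\<And>x y. x \<in> carrier V \<Longrightarrow> y \<in> carrier V \<Longrightarrow> \<phi> (x \<oplus>\<^bsub>V\<^esub> y) = \<phi> x \<oplus>\<^bsub>W\<^esub> \<phi> y"
    and "\<And>c x. c \<in> carrier K \<Longrightarrow> x \<in> carrier V \<Longrightarrow> \<phi> (c \<odot>\<^bsub>V\<^esub> x) = c \<odot>\<^bsub>W\<^esub> \<phi> x"
  shows "lin_map K V W \<phi>"
  using assms unfolding lin_map_def by auto

lemma lin_map_closed: "lin_map K V W \<phi> \<Longrightarrow> x \<in> carrier V \<Longrightarrow> \<phi> x \<in> carrier W"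
  unfolding lin_map_def by auto

lemma lin_map_add:
  "lin_map K V W \<phi> \<Longrightarrow> x \<in> carrier V \<Longrightarrow> y \<in> carrier V \<Longrightarrow> \<phi> (x \<oplus>\<^bsub>V\<^esub> y) = \<phi> x \<oplus>\<^bsub>W\<^esub> \<phi> y"
  unfolding lin_map_def by auto

lemma lin_map_smult:
  "lin_map K V W \<phi> \<Longrightarrow> c \<in> carrier K \<Longrightarrow> x \<in> carrier V \<Longrightarrow> \<phi> (c \<odot>\<^bsub>V\<^esub> x) = c \<odot>\<^bsub>W\<^esub> \<phi> x"
  unfolding lin_map_def by auto

lemma lin_map_abelian_group_hom:
  assumes "module K V" "module K W" "lin_map K V W \<phi>"
  shows "abelian_group_hom V W \<phi>"
proof -
  interpret V: module K V by fact
  interpret W: module K W by fact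
  show ?thesis
    using assms(3)
    by (intro abelian_group_homI V.abelian_group_axioms W.abelian_group_axioms)
      (auto simp: group_hom_def group_hom_axioms_def hom_def lin_map_def V.a_group W.a_group)
qed

lemma lin_map_zero:
  assumes "module K V" "module K W" "lin_map K V W \<phi>"
  shows "\<phi> \<zero>\<^bsub>V\<^esub> = \<zero>\<^bsub>W\<^esub>"
  using abelian_group_hom.hom_zero[OF lin_map_abelian_group_hom[OF assms]] .

lemma lin_map_a_inv:
  assumes "module K V" "module K W" "lin_map K V W \<phi>" "x \<in> carrier V"
  shows "\<phi> (\<ominus>\<^bsub>V\<^esub> x) = \<ominus>\<^bsub>W\<^esub> \<phi> x"
  using abelian_group_hom.hom_a_inv[OF lin_map_abelian_group_hom[OF assms(1-3)] assms(4)] .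

lemma lin_map_inj_on:
  assumes "module K V" "module K W" "lin_map K V W \<phi>"
    and "\<And>x. x \<in> carrier V \<Longrightarrow> \<phi> x = \<zero>\<^bsub>W\<^esub> \<Longrightarrow> x = \<zero>\<^bsub>V\<^esub>"
  shows "inj_on \<phi> (carrier V)"
proof (rule inj_onI)
  interpret V: module K V by fact
  interpret W: module K W by fact
  fix x y
  assume xy: "x \<in> carrier V" "y \<in> carrier V" "\<phi> x = \<phi> y"
  have "\<phi> (x \<oplus>\<^bsub>V\<^esub> \<ominus>\<^bsub>V\<^esub> y) = \<zero>\<^bsub>W\<^esub>"
    using xy lin_map_closed[OF assms(3)]
    by (simp add: lin_map_add[OF assms(3)] lin_map_a_inv[OF assms(1-3)] W.r_neg)
  hence "x \<oplus>\<^bsub>V\<^esub> \<ominus>\<^bsub>V\<^esub> y = \<zero>\<^bsub>V\<^esub>"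
    using xy by (intro assms(4)) auto
  thus "x = y"
    using xy V.minus_equality[of x "\<ominus>\<^bsub>V\<^esub> y"] V.minus_minus[of y] by simp
qed

lemma lin_iso_trans:
  assumes "lin_iso K U V \<phi>" "lin_iso K V W \<psi>"
  shows "lin_iso K U W (\<psi> \<circ> \<phi>)"
proof -
  have 1: "lin_map K U V \<phi>" "bij_betw \<phi> (carrier U) (carrier V)"
    and 2: "lin_map K V W \<psi>" "bij_betw \<psi> (carrier V) (carrier W)"
    using assms by (auto simp: lin_iso_def)
  have "lin_map K U W (\<psi> \<circ> \<phi>)"
    using 1(1) 2(1)
    by (intro lin_mapI) (simp_all add: lin_map_closed lin_map_add[where V = U and W = V]
        lin_map_add[where V = V and W = W] lin_map_smult[where V = U and W = V]
        lin_map_smult[where V = V and W = W])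
  thus ?thesis
    using bij_betw_trans[OF 1(2) 2(2)] by (simp add: lin_iso_def)
qed

text \<open>
  Linearity of the inverse is checked after applying \<open>\<phi>\<close>; injectivity then concludes, provided that sums
  and multiples stay in the carrier of \<open>V\<close>.
\<close>

lemma lin_iso_inv:
  assumes iso: "lin_iso K V W \<phi>"
    and add: "\<And>x y. x \<in> carrier V \<Longrightarrow> y \<in> carrier V \<Longrightarrow> x \<oplus>\<^bsub>V\<^esub> y \<in> carrier V"
    and smult: "\<And>c x. c \<in> carrier K \<Longrightarrow> x \<in> carrier V \<Longrightarrow> c \<odot>\<^bsub>V\<^esub> x \<in> carrier V"
  shows "lin_iso K W V (inv_into (carrier V) \<phi>)"
proof -
  let ?\<psi> = "inv_into (carrier V) \<phi>"
  have bij: "bij_betw \<phi> (carrier V) (carrier W)" and lin: "lin_map K V W \<phi>"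
    using iso by (auto simp: lin_iso_def)
  have cl: "?\<psi> w \<in> carrier V" and r: "\<phi> (?\<psi> w) = w" if "w \<in> carrier W" for w
    using bij_betw_imp_surj_on[OF bij] inv_into_into[of w \<phi> "carrier V"] f_inv_into_f[of w \<phi> "carrier V"]
      that by auto
  have eqI: "?\<psi> w = v" if "v \<in> carrier V" "\<phi> v = w" for v w
    using bij_betw_inv_into_left[OF bij that(1)] that(2) by simp
  have "lin_map K W V ?\<psi>"
  proof (rule lin_mapI)
    show "?\<psi> (x \<oplus>\<^bsub>W\<^esub> y) = ?\<psi> x \<oplus>\<^bsub>V\<^esub> ?\<psi> y" if "x \<in> carrier W" "y \<in> carrier W" for x y
      using that by (intro eqI add) (auto simp: cl r lin_map_add[OF lin])
    show "?\<psi> (c \<odot>\<^bsub>W\<^esub> x) = c \<odot>\<^bsub>V\<^esub> ?\<psi> x" if "c \<in> carrier K" "x \<in> carrier W" for c x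
      using that by (intro eqI smult) (auto simp: cl r lin_map_smult[OF lin])
  qed (rule cl)
  thus ?thesis
    using bij by (simp add: lin_iso_def bij_betw_inv_into)
qed

text \<open>
  A nonzero vector of a space with a finite basis has a nonzero coordinate, and coordinates are
  functionals.
\<close>

lemma trivial_if_dual_trivial:
  assumes "field K" "module K V" and dim: "has_dim K V n"
    and triv: "\<And>\<phi>. \<phi> \<in> carrier (dual K V) \<Longrightarrow> \<phi> = \<zero>\<^bsub>dual K V\<^esub>"
  shows "carrier V = {\<zero>\<^bsub>V\<^esub>}"
proof -
  interpret V: module K V by fact
  interpret K: field K by fact
  obtain B where B: "finite B" "B \<subseteq> carrier V"
    and ex1: "\<And>v. v \<in> carrier V \<Longrightarrow>
      \<exists>!c. c \<in> B \<rightarrow>\<^sub>E carrier K \<and> v = finsum V (\<lambda>b. c b \<odot>\<^bsub>V\<^esub> b) B"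
    using dim unfolding has_dim_def by (elim exE conjE) (rule that, assumption+, erule bspec)
  let ?lc = "\<lambda>c. finsum V (\<lambda>b. c b \<odot>\<^bsub>V\<^esub> b) B"
  define crd where "crd v = (THE c. c \<in> B \<rightarrow>\<^sub>E carrier K \<and> v = ?lc c)" for v
  have crd: "crd v \<in> B \<rightarrow>\<^sub>E carrier K" "?lc (crd v) = v" if "v \<in> carrier V" for v
    using theI'[OF ex1[OF that]] unfolding crd_def by - (erule conjunct1, erule conjunct2[THEN sym])
  have crd_eqI: "crd v = c" if "c \<in> B \<rightarrow>\<^sub>E carrier K" "v = ?lc c" "v \<in> carrier V" for v c
    unfolding crd_def using that by (intro the1_equality ex1 conjI)
  have crd_closed: "crd v b \<in> carrier K" if "v \<in> carrier V" "b \<in> B" for v b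
    using crd(1)[OF that(1)] that(2) by auto
  have lc_cong: "?lc c = ?lc d"
    if "\<And>b. b \<in> B \<Longrightarrow> c b = d b" "\<And>b. b \<in> B \<Longrightarrow> d b \<in> carrier K" for c d
    using that B by (intro V.finsum_cong') auto
  have crd_add: "crd (v \<oplus>\<^bsub>V\<^esub> w) = (\<lambda>b\<in>B. crd v b \<oplus>\<^bsub>K\<^esub> crd w b)"
    if vw: "v \<in> carrier V" "w \<in> carrier V" for v w
  proof (rule crd_eqI)
    have "?lc (\<lambda>b\<in>B. crd v b \<oplus>\<^bsub>K\<^esub> crd w b)
        = finsum V (\<lambda>b. crd v b \<odot>\<^bsub>V\<^esub> b \<oplus>\<^bsub>V\<^esub> crd w b \<odot>\<^bsub>V\<^esub> b) B"
      using vw B crd_closed by (intro V.finsum_cong') (auto simp: V.smult_l_distr subset_iff)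
    also have "\<dots> = ?lc (crd v) \<oplus>\<^bsub>V\<^esub> ?lc (crd w)"
      using vw B crd_closed by (intro V.finsum_addf) auto
    finally show "v \<oplus>\<^bsub>V\<^esub> w = ?lc (\<lambda>b\<in>B. crd v b \<oplus>\<^bsub>K\<^esub> crd w b)"
      using vw crd by simp
  qed (use vw crd_closed in auto)
  have crd_smult: "crd (a \<odot>\<^bsub>V\<^esub> v) = (\<lambda>b\<in>B. a \<otimes>\<^bsub>K\<^esub> crd v b)"
    if av: "a \<in> carrier K" "v \<in> carrier V" for a v
  proof (rule crd_eqI)
    have "?lc (\<lambda>b\<in>B. a \<otimes>\<^bsub>K\<^esub> crd v b) = finsum V (\<lambda>b. a \<odot>\<^bsub>V\<^esub> (crd v b \<odot>\<^bsub>V\<^esub> b)) B"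
      using av B crd_closed by (intro V.finsum_cong') (auto simp: V.smult_assoc1 subset_iff)
    also have "\<dots> = a \<odot>\<^bsub>V\<^esub> ?lc (crd v)"
      using av B crd_closed by (intro V.finsum_smult_ldistr[symmetric]) auto
    finally show "a \<odot>\<^bsub>V\<^esub> v = ?lc (\<lambda>b\<in>B. a \<otimes>\<^bsub>K\<^esub> crd v b)"
      using av crd by simp
  qed (use av crd_closed in auto)
  have zero_crd: "crd v b = \<zero>\<^bsub>K\<^esub>" if "v \<in> carrier V" "b \<in> B" for v b
  proof -
    have "(\<lambda>v\<in>carrier V. crd v b) \<in> carrier (dual K V)"
      using that by (auto simp: dual_def crd_closed crd_add crd_smult)
    hence "(\<lambda>v\<in>carrier V. crd v b) = (\<lambda>v\<in>carrier V. \<zero>\<^bsub>K\<^esub>)"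
      using triv by (auto simp: dual_def)
    from fun_cong[OF this, of v] show ?thesis
      using that by simp
  qed
  have "v = \<zero>\<^bsub>V\<^esub>" if v: "v \<in> carrier V" for v
  proof -
    have "v = ?lc (\<lambda>b. \<zero>\<^bsub>K\<^esub>)"
      using lc_cong[of "crd v" "\<lambda>b. \<zero>\<^bsub>K\<^esub>"] crd(2)[OF v] zero_crd[OF v] by simp
    also have "\<dots> = finsum V (\<lambda>b. \<zero>\<^bsub>V\<^esub>) B"
      using B by (intro V.finsum_cong') auto
    finally show ?thesis
      by (simp add: V.finsum_zero)
  qed
  thus ?thesis
    by auto
qed

lemma dual_zero_closed:
  assumes "field K" "module K V"
  shows "\<zero>\<^bsub>dual K V\<^esub> \<in> carrier (dual K V)"
proof -
  interpret K: field K by fact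
  interpret V: module K V by fact
  show ?thesis
    by (auto simp: dual_def)
qed

lemma dual_trivial:
  assumes "field K" "module K V" "carrier V = {\<zero>\<^bsub>V\<^esub>}" "\<phi> \<in> carrier (dual K V)"
  shows "\<phi> = \<zero>\<^bsub>dual K V\<^esub>"
proof -
  interpret V: module K V by fact
  interpret K: field K by fact
  have "\<phi> \<in> {\<zero>\<^bsub>V\<^esub>} \<rightarrow>\<^sub>E carrier K"
    and "\<phi> \<zero>\<^bsub>V\<^esub> = \<phi> \<zero>\<^bsub>V\<^esub> \<oplus>\<^bsub>K\<^esub> \<phi> \<zero>\<^bsub>V\<^esub>"
    using assms(3,4) V.l_zero[OF V.zero_closed] by (simp_all add: dual_def)
  hence "\<phi> \<zero>\<^bsub>V\<^esub> = \<zero>\<^bsub>K\<^esub>" and "\<phi> \<in> extensional {\<zero>\<^bsub>V\<^esub>}"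
    by (auto simp: PiE_iff)
  thus ?thesis
    using assms(3) by (auto simp: dual_def fun_eq_iff extensional_def)
qed

section \<open>Limits of sequences of vector spaces\<close>

lemma UN_pair_eqI:
  assumes "(a, b) \<in> A" "\<And>x y. (x, y) \<in> A \<Longrightarrow> f x y = C"
  shows "(\<Union>(x, y)\<in>A. f x y) = C"
proof -
  have "(\<Union>(x, y)\<in>A. f x y) = (\<Union>z\<in>A. C)"
    using assms(2) by (intro SUP_cong refl) auto
  thus ?thesis
    using assms(1) by auto
qed

locale direct_system =
  fixes K :: "('k, 'r) ring_scheme" and V :: "nat \<Rightarrow> ('k, 'v, 's) module_scheme"
    and t :: "nat \<Rightarrow> 'v \<Rightarrow> 'v"
  assumes module_V: "module K (V n)"
    and lin_t: "lin_map K (V n) (V (Suc n)) (t n)"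
begin

abbreviation cls :: "nat \<Rightarrow> 'v \<Rightarrow> (nat \<times> 'v) set" where
  "cls n v \<equiv> dl_rel V t `` {(n, v)}"

lemma add_closed: "v \<in> carrier (V n) \<Longrightarrow> w \<in> carrier (V n) \<Longrightarrow> v \<oplus>\<^bsub>V n\<^esub> w \<in> carrier (V n)"
  using module_V[of n] by (meson abelian_group.axioms(1) abelian_monoid.a_closed module.axioms(2))

lemma smult_closed: "c \<in> carrier K \<Longrightarrow> v \<in> carrier (V n) \<Longrightarrow> c \<odot>\<^bsub>V n\<^esub> v \<in> carrier (V n)"
  using module_V[of n] by (meson module.smult_closed)

lemma lin_push: "lin_map K (V n) (V (n + j)) (dl_push t n j)"
proof (induction j)
  case 0
  show ?case by (simp add: lin_map_def)
next
  case (Suc j)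
  show ?case
    by (rule lin_mapI)
      (simp_all add: lin_map_closed[OF Suc] lin_map_add[OF Suc] lin_map_smult[OF Suc]
        lin_map_closed[OF lin_t] lin_map_add[OF lin_t] lin_map_smult[OF lin_t])
qed

lemma push_closed: "v \<in> carrier (V n) \<Longrightarrow> dl_push t n j v \<in> carrier (V (n + j))"
  by (rule lin_map_closed[OF lin_push])

lemma push_push: "dl_push t n (i + j) v = dl_push t (n + i) j (dl_push t n i v)"
  by (induction j) (simp_all add: add.assoc)

lemma push_push_eq:
  assumes "n' = n + i" "k = i + j"
  shows "dl_push t n' j (dl_push t n i v) = dl_push t n k v"
  using assms by (simp add: push_push)

lemma dl_relI:
  assumes "v \<in> carrier (V n)" "w \<in> carrier (V m)" "n + i = m + j" "dl_push t n i v = dl_push t m j w"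
  shows "((n, v), (m, w)) \<in> dl_rel V t"
  using assms unfolding dl_rel_def by blast

lemma dl_relE:
  assumes "((n, v), (m, w)) \<in> dl_rel V t"
  obtains i j where "v \<in> carrier (V n)" "w \<in> carrier (V m)" "n + i = m + j"
    "dl_push t n i v = dl_push t m j w"
  using assms unfolding dl_rel_def by blast

lemma equiv_dl_rel: "equiv (SIGMA n:UNIV. carrier (V n)) (dl_rel V t)"
proof (rule equivI)
  show "dl_rel V t \<subseteq> (SIGMA n:UNIV. carrier (V n)) \<times> (SIGMA n:UNIV. carrier (V n))"
    by (auto elim: dl_relE)
  show "refl_on (SIGMA n:UNIV. carrier (V n)) (dl_rel V t)"
    by (intro refl_onI) (auto intro: dl_relI[where i = 0 and j = 0])
  show "sym (dl_rel V t)"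
    by (rule symI) (fastforce elim: dl_relE intro: dl_relI[OF _ _ sym sym])
  show "trans (dl_rel V t)"
  proof (rule transI, clarify)
    fix n v m w k x
    assume "((n, v), (m, w)) \<in> dl_rel V t" "((m, w), (k, x)) \<in> dl_rel V t"
    then obtain i j i' j' where cl: "v \<in> carrier (V n)" "x \<in> carrier (V k)"
      and 1: "n + i = m + j" "dl_push t n i v = dl_push t m j w"
      and 2: "m + i' = k + j'" "dl_push t m i' w = dl_push t k j' x"
      by (elim dl_relE) blast
    have "dl_push t n (i + i') v = dl_push t m (j + i') w"
      unfolding push_push 1 ..
    also have "\<dots> = dl_push t m (i' + j) w"
      by (simp add: add.commute)
    also have "\<dots> = dl_push t k (j' + j) x"
      unfolding push_push 2 ..
    finally show "((n, v), (k, x)) \<in> dl_rel V t"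
      using cl 1(1) 2(1) by (intro dl_relI) auto
  qed
qed

lemma cls_eq_iff:
  "v \<in> carrier (V n) \<Longrightarrow> w \<in> carrier (V m) \<Longrightarrow> cls n v = cls m w \<longleftrightarrow> ((n, v), (m, w)) \<in> dl_rel V t"
  by (rule eq_equiv_class_iff[OF equiv_dl_rel]) auto

lemma cls_eq_same_level:
  assumes "v \<in> carrier (V n)" "w \<in> carrier (V n)"
  shows "cls n v = cls n w \<longleftrightarrow> (\<exists>j. dl_push t n j v = dl_push t n j w)"
  unfolding cls_eq_iff[OF assms] using assms by (auto elim!: dl_relE intro: dl_relI)

lemma cls_push: "v \<in> carrier (V n) \<Longrightarrow> cls (n + j) (dl_push t n j v) = cls n v"
  by (subst cls_eq_iff) (auto simp: push_closed intro: dl_relI[where i = 0 and j = j])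

lemma cls_closed: "v \<in> carrier (V n) \<Longrightarrow> cls n v \<in> carrier (dlim V t)"
  by (auto simp: dlim_def intro: quotientI)

lemma cls_self: "v \<in> carrier (V n) \<Longrightarrow> (n, v) \<in> cls n v"
  by (auto intro: dl_relI[where i = 0 and j = 0])

lemma mem_cls:
  assumes "(m, w) \<in> cls n v"
  shows "v \<in> carrier (V n)" "w \<in> carrier (V m)" "cls m w = cls n v"
  using assms equiv_class_eq[OF equiv_dl_rel, of "(n, v)" "(m, w)"] by (auto elim: dl_relE)

lemma dlim_cases:
  assumes "A \<in> carrier (dlim V t)"
  obtains n v where "v \<in> carrier (V n)" "A = cls n v"
  using assms by (auto simp: dlim_def elim!: quotientE)

text \<open>
  The lower bound \<open>l\<close> serves to reach a level from which on given maps are bijective.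
\<close>

lemma dlim_common_level:
  assumes "A \<in> carrier (dlim V t)" "B \<in> carrier (dlim V t)"
  obtains n v w where "l \<le> n" "v \<in> carrier (V n)" "w \<in> carrier (V n)" "A = cls n v" "B = cls n w"
proof -
  obtain n v m w where vw: "v \<in> carrier (V n)" "A = cls n v" "w \<in> carrier (V m)" "B = cls m w"
    using assms by (elim dlim_cases)
  have "cls (n + (m + l)) (dl_push t n (m + l) v) = A"
    using vw by (simp only: cls_push)
  moreover have "cls (m + (n + l)) (dl_push t m (n + l) w) = B"
    using vw by (simp only: cls_push)
  moreover have eq: "m + (n + l) = n + (m + l)"
    by simp
  moreover have "dl_push t m (n + l) w \<in> carrier (V (n + (m + l)))"
    using push_closed[OF vw(3), of "n + l"] unfolding eq .
  ultimately show thesis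
    using push_closed[OF vw(1), of "m + l"]
    by (intro that[of "n + (m + l)" "dl_push t n (m + l) v" "dl_push t m (n + l) w"]) simp_all
qed

text \<open>
  Sums of classes are defined at the level \<open>n + m\<close>.  Two choices of representatives agree after pushing both
  sums on to the level at which the representatives of both summands agree.
\<close>

lemma dlim_add_general:
  assumes v: "v \<in> carrier (V n)" and w: "w \<in> carrier (V m)"
  shows "cls n v \<oplus>\<^bsub>dlim V t\<^esub> cls m w
    = cls (n + m) (dl_push t n m v \<oplus>\<^bsub>V (n + m)\<^esub> dl_push t m n w)"
proof -
  let ?sum = "\<lambda>n v m w. dl_push t n m v \<oplus>\<^bsub>V (n + m)\<^esub> dl_push t m n w"
  have cl: "dl_push t n m v \<in> carrier (V (n + m))" "dl_push t m n w \<in> carrier (V (n + m))"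
    if "v \<in> carrier (V n)" "w \<in> carrier (V m)" for n v m w
    using push_closed[OF that(1), of m] push_closed[OF that(2), of n] by (simp_all add: add.commute)
  have rel: "cls (n' + m') (?sum n' v' m' w') = cls (n + m) (?sum n v m w)"
    if "((n, v), (n', v')) \<in> dl_rel V t" "((m, w), (m', w')) \<in> dl_rel V t" for n' v' m' w'
  proof -
    from that obtain i i' j j' where v': "v' \<in> carrier (V n')" and w': "w' \<in> carrier (V m')"
      and 1: "n + i = n' + i'" "dl_push t n i v = dl_push t n' i' v'"
      and 2: "m + j = m' + j'" "dl_push t m j w = dl_push t m' j' w'"
      by (elim dl_relE) blast
    have eq: "dl_push t (n + m) (i + j) (?sum n v m w)
        = dl_push t (n + i) (m + j) (dl_push t n i v) \<oplus>\<^bsub>V (n + m + (i + j))\<^esub>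
          dl_push t (m + j) (n + i) (dl_push t m j w)"
      if "v \<in> carrier (V n)" "w \<in> carrier (V m)" for n v m w i j
    proof -
      have "dl_push t (n + m) (i + j) (dl_push t n m v) = dl_push t n (m + i + j) v"
        by (rule push_push_eq) simp_all
      moreover have "dl_push t (n + i) (m + j) (dl_push t n i v) = dl_push t n (m + i + j) v"
        by (rule push_push_eq) simp_all
      moreover have "dl_push t (n + m) (i + j) (dl_push t m n w) = dl_push t m (n + i + j) w"
        by (rule push_push_eq) simp_all
      moreover have "dl_push t (m + j) (n + i) (dl_push t m j w) = dl_push t m (n + i + j) w"
        by (rule push_push_eq) simp_all
      ultimately show ?thesis
        using cl[OF that] by (simp add: lin_map_add[OF lin_push])
    qed
    have "n + m + (i + j) = n' + m' + (i' + j')"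
      using 1(1) 2(1) by simp
    moreover have "dl_push t (n + m) (i + j) (?sum n v m w)
        = dl_push t (n' + m') (i' + j') (?sum n' v' m' w')"
      unfolding eq[OF v w] eq[OF v' w'] 1(2) 2(2) calculation unfolding 1(1) 2(1) ..
    ultimately have "((n + m, ?sum n v m w), (n' + m', ?sum n' v' m' w')) \<in> dl_rel V t"
      using cl[OF v w] cl[OF v' w'] by (intro dl_relI add_closed)
    thus ?thesis
      using equiv_class_eq[OF equiv_dl_rel] by blast
  qed
  have "cls n v \<oplus>\<^bsub>dlim V t\<^esub> cls m w
      = (\<Union>(n', v')\<in>cls n v. \<Union>(m', w')\<in>cls m w. cls (n' + m') (?sum n' v' m' w'))"
    by (simp add: dlim_def)
  also have "\<dots> = cls (n + m) (?sum n v m w)"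
    by (rule UN_pair_eqI[OF cls_self[OF v]], rule UN_pair_eqI[OF cls_self[OF w]]) (rule rel; simp)
  finally show ?thesis .
qed

lemma dlim_add:
  assumes "v \<in> carrier (V n)" "w \<in> carrier (V n)"
  shows "cls n v \<oplus>\<^bsub>dlim V t\<^esub> cls n w = cls n (v \<oplus>\<^bsub>V n\<^esub> w)"
  using assms by (simp only: dlim_add_general lin_map_add[OF lin_push, symmetric] cls_push add_closed)

lemma dlim_smult:
  assumes c: "c \<in> carrier K" and v: "v \<in> carrier (V n)"
  shows "c \<odot>\<^bsub>dlim V t\<^esub> cls n v = cls n (c \<odot>\<^bsub>V n\<^esub> v)"
proof -
  have rel: "cls m (c \<odot>\<^bsub>V m\<^esub> w) = cls n (c \<odot>\<^bsub>V n\<^esub> v)" if "((n, v), (m, w)) \<in> dl_rel V t" for m w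
  proof -
    from that obtain i j where "w \<in> carrier (V m)" "n + i = m + j" "dl_push t n i v = dl_push t m j w"
      by (elim dl_relE)
    hence "((n, c \<odot>\<^bsub>V n\<^esub> v), (m, c \<odot>\<^bsub>V m\<^esub> w)) \<in> dl_rel V t"
      using c v by (intro dl_relI[of _ _ _ _ i j]) (simp_all add: smult_closed lin_map_smult[OF lin_push])
    thus ?thesis
      using equiv_class_eq[OF equiv_dl_rel] by blast
  qed
  have "c \<odot>\<^bsub>dlim V t\<^esub> cls n v = (\<Union>(m, w)\<in>cls n v. cls m (c \<odot>\<^bsub>V m\<^esub> w))"
    by (simp add: dlim_def)
  also have "\<dots> = cls n (c \<odot>\<^bsub>V n\<^esub> v)"
    by (rule UN_pair_eqI[OF cls_self[OF v]]) (rule rel; simp)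
  finally show ?thesis .
qed

lemma dlim_add_closed:
  assumes "A \<in> carrier (dlim V t)" "B \<in> carrier (dlim V t)"
  shows "A \<oplus>\<^bsub>dlim V t\<^esub> B \<in> carrier (dlim V t)"
  by (rule dlim_common_level[OF assms, where l = 0]) (simp add: dlim_add cls_closed add_closed)

lemma dlim_smult_closed:
  assumes "c \<in> carrier K" "A \<in> carrier (dlim V t)"
  shows "c \<odot>\<^bsub>dlim V t\<^esub> A \<in> carrier (dlim V t)"
  by (rule dlim_cases[OF assms(2)]) (simp add: assms(1) dlim_smult cls_closed smult_closed)

lemma dlim_lin_mapI:
  assumes "\<And>n v. v \<in> carrier (V n) \<Longrightarrow> \<phi> (cls n v) \<in> carrier W"
    and "\<And>n v w. v \<in> carrier (V n) \<Longrightarrow> w \<in> carrier (V n) \<Longrightarrow>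
      \<phi> (cls n (v \<oplus>\<^bsub>V n\<^esub> w)) = \<phi> (cls n v) \<oplus>\<^bsub>W\<^esub> \<phi> (cls n w)"
    and "\<And>c n v. c \<in> carrier K \<Longrightarrow> v \<in> carrier (V n) \<Longrightarrow>
      \<phi> (cls n (c \<odot>\<^bsub>V n\<^esub> v)) = c \<odot>\<^bsub>W\<^esub> \<phi> (cls n v)"
  shows "lin_map K (dlim V t) W \<phi>"
proof (rule lin_mapI)
  show "\<phi> A \<in> carrier W" if "A \<in> carrier (dlim V t)" for A
    using that assms(1) by (elim dlim_cases) simp
  show "\<phi> (A \<oplus>\<^bsub>dlim V t\<^esub> B) = \<phi> A \<oplus>\<^bsub>W\<^esub> \<phi> B"
    if AB: "A \<in> carrier (dlim V t)" "B \<in> carrier (dlim V t)" for A B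
    by (rule dlim_common_level[OF AB, where l = 0]) (simp add: dlim_add assms(2))
  show "\<phi> (c \<odot>\<^bsub>dlim V t\<^esub> A) = c \<odot>\<^bsub>W\<^esub> \<phi> A"
    if "c \<in> carrier K" "A \<in> carrier (dlim V t)" for c A
    using that by (elim dlim_cases) (simp add: dlim_smult assms(3))
qed

end

locale direct_system_map = V: direct_system K V t + W: direct_system K W r
  for K :: "('k, 'q) ring_scheme"
    and V :: "nat \<Rightarrow> ('k, 'v, 's) module_scheme" and t :: "nat \<Rightarrow> 'v \<Rightarrow> 'v"
    and W :: "nat \<Rightarrow> ('k, 'w, 'u) module_scheme" and r :: "nat \<Rightarrow> 'w \<Rightarrow> 'w" +
  fixes \<phi> :: "nat \<Rightarrow> 'v \<Rightarrow> 'w"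
  assumes lin: "lin_map K (V n) (W n) (\<phi> n)"
    and comm: "v \<in> carrier (V n) \<Longrightarrow> \<phi> (Suc n) (t n v) = r n (\<phi> n v)"
begin

lemma map_closed: "v \<in> carrier (V n) \<Longrightarrow> \<phi> n v \<in> carrier (W n)"
  by (rule lin_map_closed[OF lin])

lemma push_map:
  "v \<in> carrier (V n) \<Longrightarrow> dl_push r n j (\<phi> n v) = \<phi> (n + j) (dl_push t n j v)"
  by (induction j) (simp_all add: comm V.push_closed)

lemma dlim_map_cls:
  assumes v: "v \<in> carrier (V n)"
  shows "dlim_map W r \<phi> (V.cls n v) = W.cls n (\<phi> n v)"
proof -
  have "W.cls m (\<phi> m w) = W.cls n (\<phi> n v)" if mw: "((n, v), (m, w)) \<in> dl_rel V t" for m w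
  proof -
    obtain i j where w: "w \<in> carrier (V m)"
      and ij: "n + i = m + j" "dl_push t n i v = dl_push t m j w"
      using mw by (elim V.dl_relE)
    have "((n, \<phi> n v), (m, \<phi> m w)) \<in> dl_rel W r"
      using v w ij by (intro W.dl_relI[of _ _ _ _ i j] map_closed) (simp_all add: push_map)
    thus ?thesis
      using equiv_class_eq[OF W.equiv_dl_rel] by blast
  qed
  thus ?thesis
    unfolding dlim_map_def by (rule UN_pair_eqI[OF V.cls_self[OF v]]) simp
qed

lemma lin_map_dlim_map: "lin_map K (dlim V t) (dlim W r) (dlim_map W r \<phi>)"
  by (rule V.dlim_lin_mapI)
    (simp_all add: dlim_map_cls V.add_closed V.smult_closed map_closed W.cls_closed W.dlim_add W.dlim_smult
      lin_map_add[OF lin] lin_map_smult[OF lin])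

text \<open>
  Every class of a direct limit has representatives at all high levels, and equality of two classes is
  visible at a high level, so bijectivity of the maps from some level on suffices.
\<close>

lemma lin_iso_dlim_map:
  assumes bij: "\<And>n. n0 \<le> n \<Longrightarrow> bij_betw (\<phi> n) (carrier (V n)) (carrier (W n))"
  shows "lin_iso K (dlim V t) (dlim W r) (dlim_map W r \<phi>)"
proof -
  have "inj_on (dlim_map W r \<phi>) (carrier (dlim V t))"
  proof (rule inj_onI)
    fix A B
    assume AB: "A \<in> carrier (dlim V t)" "B \<in> carrier (dlim V t)"
      and eq: "dlim_map W r \<phi> A = dlim_map W r \<phi> B"
    obtain n v w where n: "n0 \<le> n" and vw: "v \<in> carrier (V n)" "w \<in> carrier (V n)"
      and AB': "A = V.cls n v" "B = V.cls n w"
      by (rule V.dlim_common_level[OF AB])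
    have "W.cls n (\<phi> n v) = W.cls n (\<phi> n w)"
      using eq vw by (simp add: AB' dlim_map_cls)
    then obtain j where "dl_push r n j (\<phi> n v) = dl_push r n j (\<phi> n w)"
      unfolding W.cls_eq_same_level[OF vw[THEN map_closed]] by blast
    hence "\<phi> (n + j) (dl_push t n j v) = \<phi> (n + j) (dl_push t n j w)"
      using vw by (simp add: push_map)
    moreover have "inj_on (\<phi> (n + j)) (carrier (V (n + j)))"
      using n by (intro bij_betw_imp_inj_on[OF bij]) simp
    ultimately have "dl_push t n j v = dl_push t n j w"
      using V.push_closed[OF vw(1), of j] V.push_closed[OF vw(2), of j] by (elim inj_onD)
    thus "A = B"
      unfolding AB' V.cls_eq_same_level[OF vw] by blast
  qed
  moreover have "dlim_map W r \<phi> ` carrier (dlim V t) = carrier (dlim W r)"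
  proof (intro equalityI subsetI)
    fix B
    assume "B \<in> dlim_map W r \<phi> ` carrier (dlim V t)"
    then obtain A where A: "A \<in> carrier (dlim V t)" "B = dlim_map W r \<phi> A"
      by blast
    show "B \<in> carrier (dlim W r)"
      by (rule V.dlim_cases[OF A(1)]) (simp add: A(2) dlim_map_cls map_closed W.cls_closed)
  next
    fix B
    assume B: "B \<in> carrier (dlim W r)"
    obtain n w where n: "n0 \<le> n" and w: "w \<in> carrier (W n)" "B = W.cls n w"
      by (rule W.dlim_common_level[OF B B, where l = n0])
    have "w \<in> \<phi> n ` carrier (V n)"
      using bij_betw_imp_surj_on[OF bij[OF n]] w(1) by simp
    then obtain v where v: "v \<in> carrier (V n)" "w = \<phi> n v"
      by (rule imageE)
    show "B \<in> dlim_map W r \<phi> ` carrier (dlim V t)"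
    proof (rule image_eqI)
      show "B = dlim_map W r \<phi> (V.cls n v)"
        by (simp only: dlim_map_cls[OF v(1)] w(2) v(2))
      show "V.cls n v \<in> carrier (dlim V t)"
        by (rule V.cls_closed[OF v(1)])
    qed
  qed
  ultimately show ?thesis
    by (simp add: lin_iso_def bij_betw_def lin_map_dlim_map)
qed

end

text \<open>
  When the transition maps are bijective from the index \<open>n0\<close> on, an entry at \<open>n0\<close> extends uniquely, upwards by
  inverting the transition maps and downwards by applying them.
\<close>

lemma lin_iso_invlim_proj:
  assumes closed: "\<And>n x. x \<in> carrier (V (Suc n)) \<Longrightarrow> t n x \<in> carrier (V n)"
    and bij: "\<And>n. n0 \<le> n \<Longrightarrow> bij_betw (t n) (carrier (V (Suc n))) (carrier (V n))"
  shows "lin_iso K (invlim V t) (V n0) (\<lambda>x. x n0)"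
proof -
  have "lin_map K (invlim V t) (V n0) (\<lambda>x. x n0)"
    by (rule lin_mapI) (simp_all add: invlim_def)
  moreover have "inj_on (\<lambda>x. x n0) (carrier (invlim V t))"
  proof (rule inj_onI)
    fix x y
    assume "x \<in> carrier (invlim V t)" "y \<in> carrier (invlim V t)" and eq: "x n0 = y n0"
    hence x: "x n \<in> carrier (V n)" "t n (x (Suc n)) = x n"
      and y: "y n \<in> carrier (V n)" "t n (y (Suc n)) = y n" for n
      by (auto simp: invlim_def)
    have "x (n0 + j) = y (n0 + j)" for j
    proof (induction j)
      case (Suc j)
      have "t (n0 + j) (x (Suc (n0 + j))) = t (n0 + j) (y (Suc (n0 + j)))"
        using Suc x y by simp
      thus ?case
        using inj_onD[OF bij_betw_imp_inj_on[OF bij[of "n0 + j"]]] x(1) y(1) by simp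
    qed (simp add: eq)
    hence "x n = y n" if "n0 \<le> n" for n
      using that by (metis le_add_diff_inverse)
    moreover have "x n = y n" if "n \<le> n0" for n
      using that by (induction rule: inc_induct) (metis eq, metis x(2) y(2))
    ultimately show "x = y"
      by (meson ext nat_le_linear)
  qed
  moreover have "\<exists>x\<in>carrier (invlim V t). x n0 = y" if y: "y \<in> carrier (V n0)" for y
  proof -
    define up where "up = rec_nat y (\<lambda>j. inv_into (carrier (V (Suc (n0 + j)))) (t (n0 + j)))"
    define down where "down = rec_nat y (\<lambda>j. t (n0 - Suc j))"
    define x where "x n = (if n0 \<le> n then up (n - n0) else down (n0 - n))" for n
    have up_Suc: "up (Suc j) = inv_into (carrier (V (Suc (n0 + j)))) (t (n0 + j)) (up j)" for j
      by (simp add: up_def)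
    have up: "up j \<in> carrier (V (n0 + j))" for j
    proof (induction j)
      case (Suc j)
      thus ?case
        using bij_betw_imp_surj_on[OF bij, of "n0 + j"] by (auto simp: up_Suc intro!: inv_into_into)
    qed (simp add: up_def y)
    have t_up: "t (n0 + j) (up (Suc j)) = up j" for j
      using bij_betw_imp_surj_on[OF bij, of "n0 + j"] up[of j] by (simp add: up_Suc f_inv_into_f)
    have down: "down j \<in> carrier (V (n0 - j))" if "j \<le> n0" for j
      using that
    proof (induction j)
      case (Suc j)
      hence "Suc (n0 - Suc j) = n0 - j"
        by simp
      with Suc show ?case
        by (auto simp: down_def intro!: closed)
    qed (simp add: down_def y)
    have "x n \<in> carrier (V n)" for n
      using up[of "n - n0"] down[of "n0 - n"] by (auto simp: x_def)
    moreover have "t n (x (Suc n)) = x n" for n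
    proof (cases "n0 \<le> n")
      case True
      thus ?thesis
        using t_up[of "n - n0"] by (simp add: x_def Suc_diff_le)
    next
      case False
      have "x (Suc n) = down (n0 - Suc n)"
        using False by (auto simp: x_def up_def down_def not_le dest: le_antisym)
      moreover have "n0 - n = Suc (n0 - Suc n)"
        using False by simp
      ultimately show ?thesis
        using False by (simp add: x_def down_def)
    qed
    moreover have "x n0 = y"
      by (simp add: x_def up_def)
    ultimately show ?thesis
      by (intro bexI[of _ x]) (simp_all add: invlim_def)
  qed
  moreover have "x n0 \<in> carrier (V n0)" if "x \<in> carrier (invlim V t)" for x
    using that by (simp add: invlim_def)
  ultimately show ?thesis
    unfolding lin_iso_def bij_betw_def by blast
qed

section \<open>Hom-spaces and triangles\<close>

text \<open>The dot of a composite also denotes the product of ideals.\<close>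

no_notation ideal_prod (infixl \<open>\<cdot>\<index>\<close> 70)

context linear_category
begin

abbreviation comp (infixl \<open>\<bullet>\<close> 70) where
  "g \<bullet> f \<equiv> g \<cdot>\<^bsub>T\<^esub> f"

abbreviation zero_mor where
  "zero_mor X Y \<equiv> \<zero>\<^bsub>Hom T X Y\<^esub>"

abbreviation orth where
  "orth X Y \<equiv> homs T X Y = {zero_mor X Y}"

lemma zero_mor_closed: "zero_mor X Y \<in> homs T X Y"
  by (rule abelian_monoid.zero_closed[OF abelian_group.axioms(1)[OF module.axioms(2)[OF module_Hom]]])

lemma neg_closed: "f \<in> homs T X Y \<Longrightarrow> \<ominus>\<^bsub>Hom T X Y\<^esub> f \<in> homs T X Y"
  by (rule abelian_group.a_inv_closed[OF module.axioms(2)[OF module_Hom]])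

lemma neg_neg: "f \<in> homs T X Y \<Longrightarrow> \<ominus>\<^bsub>Hom T X Y\<^esub> (\<ominus>\<^bsub>Hom T X Y\<^esub> f) = f"
  by (rule abelian_group.minus_minus[OF module.axioms(2)[OF module_Hom]])

lemma plus_closed: "f \<in> homs T X Y \<Longrightarrow> g \<in> homs T X Y \<Longrightarrow> f \<oplus>\<^bsub>Hom T X Y\<^esub> g \<in> homs T X Y"
  by (rule abelian_monoid.a_closed[OF abelian_group.axioms(1)[OF module.axioms(2)[OF module_Hom]]])

lemma scale_closed: "c \<in> carrier K \<Longrightarrow> f \<in> homs T X Y \<Longrightarrow> c \<odot>\<^bsub>Hom T X Y\<^esub> f \<in> homs T X Y"
  by (rule module.smult_closed[OF module_Hom])

lemma neg_inj:
  "f \<in> homs T X Y \<Longrightarrow> g \<in> homs T X Y \<Longrightarrow> \<ominus>\<^bsub>Hom T X Y\<^esub> f = \<ominus>\<^bsub>Hom T X Y\<^esub> g \<Longrightarrow> f = g"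
  using neg_neg by metis

lemma plus_neg_eq_zero_iff:
  assumes "f \<in> homs T X Y" "g \<in> homs T X Y"
  shows "f \<oplus>\<^bsub>Hom T X Y\<^esub> \<ominus>\<^bsub>Hom T X Y\<^esub> g = zero_mor X Y \<longleftrightarrow> f = g"
proof -
  interpret H: module K "Hom T X Y" by (rule module_Hom)
  show ?thesis
    using H.minus_equality[of f "\<ominus>\<^bsub>Hom T X Y\<^esub> g"] H.minus_minus[of g] H.r_neg[of g] assms by auto
qed

lemma comp_zero_left: "f \<in> homs T X Y \<Longrightarrow> zero_mor Y Z \<bullet> f = zero_mor X Z"
  by (rule lin_map_zero[OF module_Hom module_Hom Cmp_lin_left])

lemma comp_zero_right: "g \<in> homs T Y Z \<Longrightarrow> g \<bullet> zero_mor X Y = zero_mor X Z"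
  by (rule lin_map_zero[OF module_Hom module_Hom Cmp_lin_right])

lemma comp_neg_left:
  "f \<in> homs T X Y \<Longrightarrow> g \<in> homs T Y Z \<Longrightarrow> (\<ominus>\<^bsub>Hom T Y Z\<^esub> g) \<bullet> f = \<ominus>\<^bsub>Hom T X Z\<^esub> (g \<bullet> f)"
  by (rule lin_map_a_inv[OF module_Hom module_Hom Cmp_lin_left])

lemma comp_neg_right:
  "f \<in> homs T X Y \<Longrightarrow> g \<in> homs T Y Z \<Longrightarrow> g \<bullet> (\<ominus>\<^bsub>Hom T X Y\<^esub> f) = \<ominus>\<^bsub>Hom T X Z\<^esub> (g \<bullet> f)"
  by (rule lin_map_a_inv[OF module_Hom module_Hom Cmp_lin_right])

lemma comp_plus_left:
  "f \<in> homs T X Y \<Longrightarrow> g \<in> homs T Y Z \<Longrightarrow> g' \<in> homs T Y Z \<Longrightarrow>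
    (g \<oplus>\<^bsub>Hom T Y Z\<^esub> g') \<bullet> f = g \<bullet> f \<oplus>\<^bsub>Hom T X Z\<^esub> g' \<bullet> f"
  by (rule lin_map_add[OF Cmp_lin_left])

lemma comp_plus_right:
  "f \<in> homs T X Y \<Longrightarrow> f' \<in> homs T X Y \<Longrightarrow> g \<in> homs T Y Z \<Longrightarrow>
    g \<bullet> (f \<oplus>\<^bsub>Hom T X Y\<^esub> f') = g \<bullet> f \<oplus>\<^bsub>Hom T X Z\<^esub> g \<bullet> f'"
  by (rule lin_map_add[OF Cmp_lin_right])

lemma comp_scale_left:
  "f \<in> homs T X Y \<Longrightarrow> g \<in> homs T Y Z \<Longrightarrow> c \<in> carrier K \<Longrightarrow>
    (c \<odot>\<^bsub>Hom T Y Z\<^esub> g) \<bullet> f = c \<odot>\<^bsub>Hom T X Z\<^esub> (g \<bullet> f)"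
  by (rule lin_map_smult[OF Cmp_lin_left])

lemma comp_scale_right:
  "f \<in> homs T X Y \<Longrightarrow> g \<in> homs T Y Z \<Longrightarrow> c \<in> carrier K \<Longrightarrow>
    g \<bullet> (c \<odot>\<^bsub>Hom T X Y\<^esub> f) = c \<odot>\<^bsub>Hom T X Z\<^esub> (g \<bullet> f)"
  by (rule lin_map_smult[OF Cmp_lin_right])

lemma comp_neg_eq_zero:
  assumes "f \<in> homs T X Y" "g \<in> homs T Y Z" "g \<bullet> f = zero_mor X Z"
  shows "(\<ominus>\<^bsub>Hom T Y Z\<^esub> g) \<bullet> f = zero_mor X Z"
proof -
  interpret H: module K "Hom T X Z" by (rule module_Hom)
  show ?thesis
    unfolding comp_neg_left[OF assms(1,2)] assms(3) by (rule H.minus_equality) simp_all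
qed

lemma orthI: "(\<And>u. u \<in> homs T X Y \<Longrightarrow> u = zero_mor X Y) \<Longrightarrow> orth X Y"
  using zero_mor_closed by blast

lemma orthD: "orth X Y \<Longrightarrow> u \<in> homs T X Y \<Longrightarrow> u = zero_mor X Y"
  by simp

lemma orth_retract_left:
  assumes "orth X' Y" "i \<in> homs T X X'" "r \<in> homs T X' X" "r \<bullet> i = Idt T X"
  shows "orth X Y"
proof (rule orthI)
  fix u
  assume u: "u \<in> homs T X Y"
  have "u = (u \<bullet> r) \<bullet> i"
    using Cmp_assoc[OF assms(2,3) u] Cmp_Idt_right[OF u] assms(4) by simp
  also have "u \<bullet> r = zero_mor X' Y"
    by (rule orthD[OF assms(1) Cmp_closed[OF assms(3) u]])
  also have "\<dots> \<bullet> i = zero_mor X Y"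
    by (rule comp_zero_left[OF assms(2)])
  finally show "u = zero_mor X Y" .
qed

lemma orth_retract_right:
  assumes "orth Y X'" "i \<in> homs T X X'" "r \<in> homs T X' X" "r \<bullet> i = Idt T X"
  shows "orth Y X"
proof (rule orthI)
  fix u
  assume u: "u \<in> homs T Y X"
  have "u = r \<bullet> (i \<bullet> u)"
    using Cmp_assoc[OF u assms(2,3)] Cmp_Idt_left[OF u] assms(4) by simp
  also have "i \<bullet> u = zero_mor Y X'"
    by (rule orthD[OF assms(1) Cmp_closed[OF u assms(2)]])
  also have "r \<bullet> \<dots> = zero_mor Y X"
    by (rule comp_zero_right[OF assms(3)])
  finally show "u = zero_mor Y X" .
qed

lemma is_iso_cases:
  assumes "is_iso T X Y f"
  obtains g where "f \<in> homs T X Y" "g \<in> homs T Y X" "g \<bullet> f = Idt T X" "f \<bullet> g = Idt T Y"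
  using assms unfolding is_iso_def by blast

lemma is_iso_Idt: "is_iso T X X (Idt T X)"
  unfolding is_iso_def using Idt_closed Cmp_Idt_left[OF Idt_closed] by blast

lemma isomorphic_sym: "isomorphic T X Y \<Longrightarrow> isomorphic T Y X"
  unfolding isomorphic_def is_iso_def by blast

lemma orth_isomorphic_left: "isomorphic T X Y \<Longrightarrow> orth X Z \<Longrightarrow> orth Y Z"
  unfolding isomorphic_def by (meson is_iso_cases orth_retract_left)

lemma orth_isomorphic_right: "isomorphic T X Y \<Longrightarrow> orth Z X \<Longrightarrow> orth Z Y"
  unfolding isomorphic_def by (meson is_iso_cases orth_retract_right)

lemma zero_object_orth:
  assumes "zero_object T Z"
  shows "orth Z Y" "orth Y Z"
  using assms unfolding zero_object_def by blast+

lemma direct_sum2_retract: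
  assumes "direct_sum2 T X X' Y"
  obtains i r where "i \<in> homs T X Y" "r \<in> homs T Y X" "r \<bullet> i = Idt T X"
proof -
  let ?Xs = "\<lambda>a::nat. if a = 0 then X else X'"
  from assms obtain i p where
    "\<forall>a<2. i a \<in> homs T (?Xs a) Y \<and> p a \<in> homs T Y (?Xs a)"
    "\<forall>a<2. \<forall>b<2. p b \<bullet> i a = (if a = b then Idt T (?Xs a) else zero_mor (?Xs a) (?Xs b))"
    unfolding direct_sum2_def direct_sum_def by (elim exE conjE)
  from this(1)[rule_format, of 0] this(2)[rule_format, of 0 0]
  show thesis
    by (intro that[of "i 0" "p 0"]) simp_all
qed

end

context triangulated_category
begin

lemma tri_homs:
  assumes "(X, Y, Z, f, g, h) \<in> Tri T"
  shows "f \<in> homs T X Y" "g \<in> homs T Y Z" "h \<in> homs T Z (Susp T X)"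
  using Tri_candidate[OF assms] by (simp_all add: candidate_triangle_def)

lemma Susp_closed: "f \<in> homs T X Y \<Longrightarrow> SuspM T f \<in> homs T (Susp T X) (Susp T Y)"
  by (rule lin_map_closed[OF Susp_linear])

lemma Susp_zero_mor: "SuspM T (zero_mor X Y) = zero_mor (Susp T X) (Susp T Y)"
  by (rule lin_map_zero[OF module_Hom module_Hom Susp_linear])

lemma Susp_neg:
  "f \<in> homs T X Y \<Longrightarrow>
    SuspM T (\<ominus>\<^bsub>Hom T X Y\<^esub> f) = \<ominus>\<^bsub>Hom T (Susp T X) (Susp T Y)\<^esub> (SuspM T f)"
  by (rule lin_map_a_inv[OF module_Hom module_Hom Susp_linear])

lemma Susp_Idt: "SuspM T (Idt T X) = Idt T (Susp T X)"
  using Susp_functor unfolding additive_functor_def by blast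

lemma Susp_comp:
  "f \<in> homs T X Y \<Longrightarrow> g \<in> homs T Y Z \<Longrightarrow> SuspM T (g \<bullet> f) = SuspM T g \<bullet> SuspM T f"
  using Susp_functor unfolding additive_functor_def by blast

lemma Susp_bij: "bij_betw (SuspM T) (homs T X Y) (homs T (Susp T X) (Susp T Y))"
  using Susp_equivalence unfolding equivalence_on_def by blast

lemma Susp_faithful:
  "f \<in> homs T X Y \<Longrightarrow> g \<in> homs T X Y \<Longrightarrow> SuspM T f = SuspM T g \<Longrightarrow> f = g"
  using bij_betw_imp_inj_on[OF Susp_bij] by (rule inj_onD)

lemma Susp_full:
  assumes "c \<in> homs T (Susp T X) (Susp T Y)"
  obtains w where "w \<in> homs T X Y" "c = SuspM T w"
  using assms bij_betw_imp_surj_on[OF Susp_bij, of X Y] by blast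

lemma orth_Susp_iff: "orth (Susp T X) (Susp T Y) \<longleftrightarrow> orth X Y"
proof
  assume *: "orth (Susp T X) (Susp T Y)"
  show "orth X Y"
  proof (rule orthI)
    fix u
    assume u: "u \<in> homs T X Y"
    show "u = zero_mor X Y"
      using orthD[OF * Susp_closed[OF u]]
      by (intro Susp_faithful[OF u zero_mor_closed]) (simp only: Susp_zero_mor)
  qed
next
  assume *: "orth X Y"
  show "orth (Susp T X) (Susp T Y)"
  proof (rule orthI)
    fix u
    assume "u \<in> homs T (Susp T X) (Susp T Y)"
    then obtain w where w: "w \<in> homs T X Y" "u = SuspM T w"
      by (rule Susp_full)
    show "u = zero_mor (Susp T X) (Susp T Y)"
      unfolding w(2) orthD[OF * w(1)] by (rule Susp_zero_mor)
  qed
qed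

lemma Susp_desusp: "isomorphic T (Susp T (desusp T X)) X"
proof -
  have "\<exists>Z. isomorphic T (Susp T Z) X"
    using Susp_equivalence unfolding equivalence_on_def by blast
  thus ?thesis
    unfolding desusp_def by (rule someI_ex)
qed

lemma rotate:
  assumes "(X, Y, Z, f, g, h) \<in> Tri T"
  shows "(Y, Z, Susp T X, g, h, \<ominus>\<^bsub>Hom T (Susp T X) (Susp T Y)\<^esub> (SuspM T f)) \<in> Tri T"
  using Tri_rotate[OF Tri_candidate[OF assms]] assms by simp

text \<open>
  Map the triangle on the identity of \<open>X\<close> to the given one; its third object is zero.
\<close>

lemma tri_comp_zero:
  assumes "(X, Y, Z, f, g, h) \<in> Tri T"
  shows "g \<bullet> f = zero_mor X Z"
proof -
  obtain N where N: "zero_object T N"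
    using zero_object_exists by blast
  have f: "f \<in> homs T X Y"
    using tri_homs[OF assms] by simp
  obtain c where "triangle_morphism T
      (X, X, N, Idt T X, zero_mor X N, zero_mor N (Susp T X)) (X, Y, Z, f, g, h) (Idt T X) f c"
    using Tri_fill[OF Tri_Idt[OF N] assms Idt_closed f refl] by blast
  hence "c \<in> homs T N Z" "c \<bullet> zero_mor X N = g \<bullet> f"
    by (simp_all add: triangle_morphism_def)
  thus ?thesis
    using comp_zero_right by metis
qed

text \<open>
  The first map of a triangle is a weak kernel of the second one and the third object a weak cokernel of
  the first map: compare with the triangles on an identity of the object at hand.
\<close>

lemma tri_weak_kernel:
  assumes tri: "(X, Y, Z, f, g, h) \<in> Tri T" and v: "v \<in> homs T W Y" "g \<bullet> v = zero_mor W Z"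
  obtains w where "w \<in> homs T W X" "v = f \<bullet> w"
proof -
  obtain N where N: "zero_object T N"
    using zero_object_exists by blast
  note f = tri_homs(1)[OF tri]
  let ?neg = "\<lambda>A B. a_inv (Hom T (Susp T A) (Susp T B))"
  have eq: "zero_mor N Z \<bullet> zero_mor W N = g \<bullet> v"
    using comp_zero_left[OF zero_mor_closed[of W N], of Z] v(2) by simp
  obtain c where "triangle_morphism T
      (W, N, Susp T W, zero_mor W N, zero_mor N (Susp T W), ?neg W W (SuspM T (Idt T W)))
      (Y, Z, Susp T X, g, h, ?neg X Y (SuspM T f)) v (zero_mor N Z) c"
    using Tri_fill[OF rotate[OF Tri_Idt[OF N]] rotate[OF tri] v(1) zero_mor_closed eq] by blast
  hence c: "c \<in> homs T (Susp T W) (Susp T X)"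
    and "SuspM T v \<bullet> ?neg W W (SuspM T (Idt T W)) = ?neg X Y (SuspM T f) \<bullet> c"
    by (simp_all add: triangle_morphism_def)
  hence "?neg W Y (SuspM T v) = ?neg W Y (SuspM T f \<bullet> c)"
    using comp_neg_right[OF Idt_closed Susp_closed[OF v(1)]] comp_neg_left[OF c Susp_closed[OF f]]
      Cmp_Idt_right[OF Susp_closed[OF v(1)]] by (simp add: Susp_Idt)
  hence Sv: "SuspM T v = SuspM T f \<bullet> c"
    by (rule neg_inj[OF Susp_closed[OF v(1)] Cmp_closed[OF c Susp_closed[OF f]]])
  obtain w where w: "w \<in> homs T W X" "c = SuspM T w"
    using Susp_full[OF c] .
  have "v = f \<bullet> w"
    using Sv Susp_comp[OF w(1) f] w(2) by (intro Susp_faithful[OF v(1) Cmp_closed[OF w(1) f]]) simp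
  thus thesis
    using that w(1) by blast
qed

text \<open>
  The identity of \<open>Z\<close> is zero, and this is preserved by the suspension.
\<close>

lemma Susp_zero_object:
  assumes "zero_object T Z"
  shows "zero_object T (Susp T Z)"
proof -
  have "Idt T (Susp T Z) = zero_mor (Susp T Z) (Susp T Z)"
    using orthD[OF zero_object_orth(1)[OF assms] Idt_closed[of Z]] Susp_Idt[of Z] Susp_zero_mor[of Z Z]
    by simp
  hence "u = zero_mor (Susp T Z) Y" if "u \<in> homs T (Susp T Z) Y" for u Y
    using Cmp_Idt_right[OF that] comp_zero_right[OF that] by metis
  moreover have "u = zero_mor Y (Susp T Z)" if "u \<in> homs T Y (Susp T Z)" for u Y
    using Cmp_Idt_left[OF that] comp_zero_left[OF that] calculation[OF Idt_closed] by metis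
  ultimately show ?thesis
    unfolding zero_object_def by (intro allI conjI orthI)
qed

lemma tri_weak_cokernel:
  assumes tri: "(X, Y, Z, f, g, h) \<in> Tri T" and v: "v \<in> homs T Y W" "v \<bullet> f = zero_mor X W"
  obtains w where "w \<in> homs T Z W" "v = w \<bullet> g"
proof -
  obtain N where N: "zero_object T N"
    using zero_object_exists by blast
  note fg = tri_homs(1,2)[OF tri]
  let ?t = "(N, W, W, zero_mor N W, Idt T W, zero_mor W (Susp T N))"
  have "\<ominus>\<^bsub>Hom T (Susp T N) (Susp T W)\<^esub> (SuspM T (zero_mor N W)) = zero_mor (Susp T N) (Susp T W)"
    using orthD[OF zero_object_orth(1)[OF Susp_zero_object[OF N]] neg_closed[OF Susp_closed]]
      zero_mor_closed by blast
  hence "(W, W, Susp T N, Idt T W, zero_mor W (Susp T N),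
      \<ominus>\<^bsub>Hom T (Susp T N) (Susp T W)\<^esub> (SuspM T (zero_mor N W))) \<in> Tri T"
    using Tri_Idt[OF Susp_zero_object[OF N]] by simp
  moreover have "candidate_triangle T ?t"
    by (simp add: candidate_triangle_def zero_mor_closed Idt_closed)
  ultimately have t: "?t \<in> Tri T"
    using Tri_rotate by blast
  have "v \<bullet> f = zero_mor N W \<bullet> zero_mor X N"
    using comp_zero_left[OF zero_mor_closed[of X N], of W] v(2) by simp
  then obtain c where "triangle_morphism T (X, Y, Z, f, g, h) ?t (zero_mor X N) v c"
    using Tri_fill[OF tri t zero_mor_closed v(1)] by blast
  hence "c \<in> homs T Z W" "c \<bullet> g = Idt T W \<bullet> v"
    by (simp_all add: triangle_morphism_def)
  thus thesis
    using that Cmp_Idt_left[OF v(1)] by metis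
qed

text \<open>
  The next two lemmas read the long exact Hom-sequences of a triangle.  One of the two terms that have to
  vanish involves the desuspension of \<open>Z\<close>, so its vanishing is stated after suspending once.
\<close>

lemma post_comp_bij:
  assumes tri: "(X, Y, Z, f, g, h) \<in> Tri T" and 0: "orth W Z" "orth (Susp T W) Z"
  shows "bij_betw (\<lambda>u. f \<bullet> u) (homs T W X) (homs T W Y)"
proof -
  note f = tri_homs(1)[OF tri] and g = tri_homs(2)[OF tri] and h = tri_homs(3)[OF tri]
  have "inj_on (\<lambda>u. f \<bullet> u) (homs T W X)"
  proof (rule lin_map_inj_on[OF module_Hom module_Hom Cmp_lin_right[OF f]])
    fix u
    assume u: "u \<in> homs T W X" "f \<bullet> u = zero_mor W Y"
    have "SuspM T f \<bullet> SuspM T u = zero_mor (Susp T W) (Susp T Y)"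
      using Susp_comp[OF u(1) f] u(2) Susp_zero_mor by simp
    hence "(\<ominus>\<^bsub>Hom T (Susp T X) (Susp T Y)\<^esub> (SuspM T f)) \<bullet> SuspM T u = zero_mor (Susp T W) (Susp T Y)"
      by (rule comp_neg_eq_zero[OF Susp_closed[OF u(1)] Susp_closed[OF f]])
    then obtain w where w: "w \<in> homs T (Susp T W) Z" "SuspM T u = h \<bullet> w"
      by (rule tri_weak_kernel[OF rotate[OF rotate[OF tri]] Susp_closed[OF u(1)]])
    hence "SuspM T u = SuspM T (zero_mor W X)"
      using orthD[OF 0(2) w(1)] comp_zero_right[OF h] Susp_zero_mor by simp
    thus "u = zero_mor W X"
      by (rule Susp_faithful[OF u(1) zero_mor_closed])
  qed
  moreover have "v \<in> (\<lambda>u. f \<bullet> u) ` homs T W X" if v: "v \<in> homs T W Y" for v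
  proof -
    have "g \<bullet> v = zero_mor W Z"
      by (rule orthD[OF 0(1) Cmp_closed[OF v g]])
    then obtain w where "w \<in> homs T W X" "v = f \<bullet> w"
      by (rule tri_weak_kernel[OF tri v])
    thus ?thesis
      by blast
  qed
  ultimately show ?thesis
    unfolding bij_betw_def using Cmp_closed[OF _ f] by blast
qed

lemma pre_comp_bij:
  assumes tri: "(X, Y, Z, f, g, h) \<in> Tri T" and 0: "orth Z W" "orth Z (Susp T W)"
  shows "bij_betw (\<lambda>u. u \<bullet> f) (homs T Y W) (homs T X W)"
proof -
  note f = tri_homs(1)[OF tri] and g = tri_homs(2)[OF tri] and h = tri_homs(3)[OF tri]
  have "inj_on (\<lambda>u. u \<bullet> f) (homs T Y W)"
  proof (rule lin_map_inj_on[OF module_Hom module_Hom Cmp_lin_left[OF f]])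
    fix u
    assume u: "u \<in> homs T Y W" "u \<bullet> f = zero_mor X W"
    then obtain w where w: "w \<in> homs T Z W" "u = w \<bullet> g"
      by (rule tri_weak_cokernel[OF tri])
    thus "u = zero_mor Y W"
      using orthD[OF 0(1) w(1)] comp_zero_left[OF g] by simp
  qed
  moreover have "v \<in> (\<lambda>u. u \<bullet> f) ` homs T Y W" if v: "v \<in> homs T X W" for v
  proof -
    let ?neg = "a_inv (Hom T (Susp T X) (Susp T Y))"
    have "SuspM T v \<bullet> h = zero_mor Z (Susp T W)"
      by (rule orthD[OF 0(2) Cmp_closed[OF h Susp_closed[OF v]]])
    then obtain w where w: "w \<in> homs T (Susp T Y) (Susp T W)" "SuspM T v = w \<bullet> ?neg (SuspM T f)"
      by (rule tri_weak_cokernel[OF rotate[OF rotate[OF tri]] Susp_closed[OF v]])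
    obtain u where u: "u \<in> homs T Y W" "w = SuspM T u"
      using Susp_full[OF w(1)] .
    \<comment> \<open>the sign comes from rotating the triangle twice\<close>
    let ?u = "\<ominus>\<^bsub>Hom T Y W\<^esub> u"
    have "SuspM T v = SuspM T (?u \<bullet> f)"
      unfolding w(2) u(2) Susp_comp[OF f neg_closed[OF u(1)]] Susp_neg[OF u(1)]
      by (simp only: comp_neg_left[OF Susp_closed[OF f] Susp_closed[OF u(1)]]
          comp_neg_right[OF Susp_closed[OF f] Susp_closed[OF u(1)]])
    hence "v = ?u \<bullet> f"
      by (rule Susp_faithful[OF v Cmp_closed[OF f neg_closed[OF u(1)]]])
    thus ?thesis
      using neg_closed[OF u(1)] by blast
  qed
  ultimately show ?thesis
    unfolding bij_betw_def using Cmp_closed[OF f] by blast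
qed

lemma cone_orth_left:
  assumes tri: "(X, Y, Z, f, g, h) \<in> Tri T" and 0: "orth Y W" "orth (Susp T X) W"
  shows "orth Z W"
proof (rule orthI)
  fix u
  assume u: "u \<in> homs T Z W"
  note g = tri_homs(2)[OF tri] and h = tri_homs(3)[OF tri]
  have "u \<bullet> g = zero_mor Y W"
    by (rule orthD[OF 0(1) Cmp_closed[OF g u]])
  then obtain w where w: "w \<in> homs T (Susp T X) W" "u = w \<bullet> h"
    by (rule tri_weak_cokernel[OF rotate[OF tri] u])
  thus "u = zero_mor Z W"
    using orthD[OF 0(2) w(1)] comp_zero_left[OF h] by simp
qed

lemma cone_orth_right:
  assumes tri: "(X, Y, Z, f, g, h) \<in> Tri T" and 0: "orth W Y" "orth W (Susp T X)"
  shows "orth W Z"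
proof (rule orthI)
  fix u
  assume u: "u \<in> homs T W Z"
  note g = tri_homs(2)[OF tri] and h = tri_homs(3)[OF tri]
  have "h \<bullet> u = zero_mor W (Susp T X)"
    by (rule orthD[OF 0(2) Cmp_closed[OF u h]])
  then obtain w where w: "w \<in> homs T W Y" "u = g \<bullet> w"
    by (rule tri_weak_kernel[OF rotate[OF tri] u])
  thus "u = zero_mor W Z"
    using orthD[OF 0(1) w(1)] comp_zero_right[OF g] by simp
qed

text \<open>Desuspend a cone, and absorb the sign of the rotation into the first map.\<close>

lemma Tri_cocone:
  assumes m: "m \<in> homs T Y C"
  obtains Z s h where "(Z, Y, C, s, m, h) \<in> Tri T"
proof -
  obtain D k l where D: "(Y, C, D, m, k, l) \<in> Tri T"
    using Tri_cone[OF m] by blast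
  define Z where "Z = desusp T D"
  obtain e e' where e: "e \<in> homs T (Susp T Z) D" "e' \<in> homs T D (Susp T Z)"
    "e' \<bullet> e = Idt T (Susp T Z)" "e \<bullet> e' = Idt T D"
    using Susp_desusp[of D] unfolding isomorphic_def is_iso_def Z_def by blast
  note k = tri_homs(2)[OF D] and l = tri_homs(3)[OF D]
  obtain s where s: "s \<in> homs T Z Y" "l \<bullet> e = SuspM T s"
    using Susp_full[OF Cmp_closed[OF e(1) l]] .
  let ?s = "\<ominus>\<^bsub>Hom T Z Y\<^esub> s"
  have "triangle_morphism T (Y, C, D, m, k, l) (Y, C, Susp T Z, m, e' \<bullet> k, SuspM T s)
      (Idt T Y) (Idt T C) e'"
    using m k l e Cmp_assoc[OF e(2,1) l] Cmp_Idt_right[OF m] Cmp_Idt_left[OF m]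
      Cmp_Idt_left[OF l] Cmp_Idt_right[OF l] Cmp_Idt_right[OF Cmp_closed[OF k e(2)]]
    by (simp add: triangle_morphism_def Idt_closed Susp_Idt s(2)[symmetric])
  moreover have "is_iso T D (Susp T Z) e'"
    using e unfolding is_iso_def by blast
  moreover have "candidate_triangle T (Y, C, Susp T Z, m, e' \<bullet> k, SuspM T s)"
    using m Cmp_closed[OF k e(2)] Susp_closed[OF s(1)] by (simp add: candidate_triangle_def)
  ultimately have "(Y, C, Susp T Z, m, e' \<bullet> k, SuspM T s) \<in> Tri T"
    using Tri_iso[OF D] is_iso_Idt by blast
  moreover have "SuspM T s = \<ominus>\<^bsub>Hom T (Susp T Z) (Susp T Y)\<^esub> (SuspM T ?s)"
    by (simp only: Susp_neg[OF s(1), symmetric] Susp_neg[OF neg_closed[OF s(1)], symmetric] neg_neg[OF s(1)])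
  moreover have "candidate_triangle T (Z, Y, C, ?s, m, e' \<bullet> k)"
    using m Cmp_closed[OF k e(2)] neg_closed[OF s(1)] by (simp add: candidate_triangle_def)
  ultimately have "(Z, Y, C, ?s, m, e' \<bullet> k) \<in> Tri T"
    using Tri_rotate by simp
  thus thesis
    by (rule that)
qed

end

section \<open>Thick subcategories and roofs\<close>

locale thick_in_triangulated = triangulated_category K T
  for K :: "('k, 'r) ring_scheme" and T :: "('k, 'o, 'm, 'z) tcat_scheme" +
  fixes U :: "'o set"
  assumes thick: "thick_subcategory T U"
begin

lemma thick_zero: "zero_object T Z \<Longrightarrow> Z \<in> U"
  and thick_Susp_iff: "Susp T X \<in> U \<longleftrightarrow> X \<in> U"
  and thick_cone: "(X, Y, Z, f, g, h) \<in> Tri T \<Longrightarrow> X \<in> U \<Longrightarrow> Y \<in> U \<Longrightarrow> Z \<in> U"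
  using thick unfolding thick_subcategory_def by blast+

text \<open>
  Two rotations make the suspension of \<open>Y\<close> the cone of a map from \<open>Z\<close> to the suspension of \<open>X\<close>.
\<close>

lemma thick_extension:
  assumes "(X, Y, Z, f, g, h) \<in> Tri T" "X \<in> U" "Z \<in> U"
  shows "Y \<in> U"
proof -
  have "Susp T Y \<in> U"
    using thick_cone[OF rotate[OF rotate[OF assms(1)]]] assms(2,3) thick_Susp_iff by blast
  thus ?thesis
    by (simp add: thick_Susp_iff)
qed

lemma thick_isomorphic:
  assumes "isomorphic T X Y" "X \<in> U"
  shows "Y \<in> U"
proof -
  obtain N where N: "zero_object T N"
    using zero_object_exists by blast
  obtain e e' where e: "e \<in> homs T X Y" "e' \<in> homs T Y X" "e' \<bullet> e = Idt T X" "e \<bullet> e' = Idt T Y"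
    using assms(1) unfolding isomorphic_def is_iso_def by blast
  have "(X, Y, N, e, zero_mor Y N, zero_mor N (Susp T X)) \<in> Tri T"
  proof (rule Tri_iso[OF Tri_Idt[OF N, of X]])
    show "triangle_morphism T (X, X, N, Idt T X, zero_mor X N, zero_mor N (Susp T X))
        (X, Y, N, e, zero_mor Y N, zero_mor N (Susp T X)) (Idt T X) e (Idt T N)"
      using e Cmp_Idt_left[OF zero_mor_closed[of X N]] comp_zero_left[OF e(1), of N]
        Cmp_Idt_right[OF zero_mor_closed[of N "Susp T X"]] Cmp_Idt_left[OF zero_mor_closed[of N "Susp T X"]]
      by (simp add: triangle_morphism_def Idt_closed Susp_Idt)
    show "is_iso T X Y e"
      using e unfolding is_iso_def by blast
  qed (use e in \<open>simp_all add: is_iso_Idt candidate_triangle_def zero_mor_closed\<close>)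
  thus ?thesis
    using thick_extension assms(2) thick_zero[OF N] by blast
qed

lemma quot_morsE:
  assumes "s \<in> quot_mors T U X Y"
  obtains C g h where "C \<in> U" "(X, Y, C, s, g, h) \<in> Tri T" "s \<in> homs T X Y"
  using assms tri_homs(1) unfolding quot_mors_def by blast

lemma quot_morsI: "(X, Y, C, s, g, h) \<in> Tri T \<Longrightarrow> C \<in> U \<Longrightarrow> s \<in> quot_mors T U X Y"
  unfolding quot_mors_def by blast

text \<open>
  By the octahedral axiom the cone of a composite is an extension of the two cones.
\<close>

lemma quot_mors_comp:
  assumes "f \<in> quot_mors T U X Y" "g \<in> quot_mors T U Y Z"
  shows "g \<bullet> f \<in> quot_mors T U X Z"
proof -
  obtain C i i' where f: "C \<in> U" "(X, Y, C, f, i, i') \<in> Tri T" "f \<in> homs T X Y"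
    using assms(1) by (rule quot_morsE)
  obtain D j j' where g: "D \<in> U" "(Y, Z, D, g, j, j') \<in> Tri T" "g \<in> homs T Y Z"
    using assms(2) by (rule quot_morsE)
  obtain E k k' where E: "(X, Z, E, g \<bullet> f, k, k') \<in> Tri T"
    using Tri_cone[OF Cmp_closed[OF f(3) g(3)]] by blast
  obtain u v where "(C, E, D, u, v, SuspM T i \<bullet> j') \<in> Tri T"
    using octahedral[OF f(2) g(2) E] by blast
  hence "E \<in> U"
    using thick_extension f(1) g(1) by blast
  thus ?thesis
    using E quot_morsI by blast
qed

text \<open>
  A map to an object of \<open>U\<close> is zero in the quotient; the witness is its cocone.
\<close>

lemma quot_mors_kill:
  assumes "w \<in> homs T W P" "P \<in> U"
  obtains V c where "c \<in> quot_mors T U V W" "w \<bullet> c = zero_mor V P"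
proof -
  obtain V c h where "(V, W, P, c, w, h) \<in> Tri T"
    using Tri_cocone[OF assms(1)] .
  thus thesis
    using that quot_morsI assms(2) tri_comp_zero by blast
qed

text \<open>
  The Ore condition: complete along a map from \<open>Z'\<close> to the cone of \<open>s\<close> that measures the obstruction to
  lifting \<open>f\<close> along \<open>s\<close>.
\<close>

lemma quot_mors_pullback:
  assumes "s \<in> quot_mors T U Z Y" "f \<in> homs T Z' Y"
  obtains W a b where "a \<in> homs T W Z" "b \<in> quot_mors T U W Z'" "s \<bullet> a = f \<bullet> b"
proof -
  obtain C g h where s: "C \<in> U" "(Z, Y, C, s, g, h) \<in> Tri T" "s \<in> homs T Z Y"
    using assms(1) by (rule quot_morsE)
  note g = tri_homs(2)[OF s(2)]
  obtain W b where b: "b \<in> quot_mors T U W Z'" "(g \<bullet> f) \<bullet> b = zero_mor W C"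
    using quot_mors_kill[OF Cmp_closed[OF assms(2) g] s(1)] .
  have b': "b \<in> homs T W Z'"
    using b(1) by (rule quot_morsE)
  have "g \<bullet> (f \<bullet> b) = zero_mor W C"
    using Cmp_assoc[OF b' assms(2) g] b(2) by simp
  then obtain a where "a \<in> homs T W Z" "f \<bullet> b = s \<bullet> a"
    by (rule tri_weak_kernel[OF s(2) Cmp_closed[OF b' assms(2)]])
  thus thesis
    using that b(1) by metis
qed

lemma quot_mors_common_denominator:
  assumes "s \<in> quot_mors T U Z Y" "s' \<in> quot_mors T U Z' Y"
  obtains W a b where "a \<in> homs T W Z" "b \<in> homs T W Z'" "s \<bullet> a = s' \<bullet> b"
    "s \<bullet> a \<in> quot_mors T U W Y"
proof -
  have "s' \<in> homs T Z' Y"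
    using assms(2) by (rule quot_morsE)
  then obtain W a b where ab: "a \<in> homs T W Z" "b \<in> quot_mors T U W Z'" "s \<bullet> a = s' \<bullet> b"
    by (rule quot_mors_pullback[OF assms(1)])
  moreover have "b \<in> homs T W Z'"
    using ab(2) by (rule quot_morsE)
  moreover have "s \<bullet> a \<in> quot_mors T U W Y"
    unfolding ab(3) by (rule quot_mors_comp[OF ab(2) assms(2)])
  ultimately show thesis
    using that by blast
qed

end

section \<open>Vanishing of Hom-spaces in an SMC quadruple\<close>

lemma mem_left_perp_shifts_iff:
  "W \<in> left_perp T (shifts T M S) \<longleftrightarrow>
    (\<forall>j\<in>M. \<forall>s\<in>S. homs T W (shift T j s) = {\<zero>\<^bsub>Hom T W (shift T j s)\<^esub>})"
  unfolding left_perp_def shifts_def by blast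

context triangulated_category
begin

text \<open>
  Negative shifts are iterated chosen desuspensions, so that the two sides are only isomorphic.
\<close>

lemma Susp_shift: "isomorphic T (Susp T (shift T j X)) (shift T (j + 1) X)"
proof (cases "0 \<le> j")
  case True
  hence "shift T (j + 1) X = Susp T (shift T j X)"
    by (simp add: shift_def nat_add_distrib)
  thus ?thesis
    using is_iso_Idt unfolding isomorphic_def by auto
next
  case False
  have "nat (- j) = Suc (nat (- (j + 1)))"
    using False by simp
  hence "shift T j X = desusp T (shift T (j + 1) X)"
    using False by (auto simp: shift_def)
  thus ?thesis
    using Susp_desusp by simp
qed

lemma orth_Susp_shift_iff: "orth (Susp T W) (shift T (j + 1) X) \<longleftrightarrow> orth W (shift T j X)"
proof -
  have "orth (Susp T W) (shift T (j + 1) X) \<longleftrightarrow> orth (Susp T W) (Susp T (shift T j X))"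
    by (rule iffI; erule orth_isomorphic_right[OF Susp_shift] orth_isomorphic_right[OF isomorphic_sym[OF Susp_shift]])
  thus ?thesis
    by (simp only: orth_Susp_iff)
qed

lemma Susp_left_perp_shifts_iff:
  "Susp T W \<in> left_perp T (shifts T M S) \<longleftrightarrow> W \<in> left_perp T (shifts T {j. j + 1 \<in> M} S)"
proof -
  have "(\<forall>j\<in>M. \<forall>s\<in>S. orth (Susp T W) (shift T j s)) \<longleftrightarrow>
      (\<forall>j. j + 1 \<in> M \<longrightarrow> (\<forall>s\<in>S. orth (Susp T W) (shift T (j + 1) s)))"
  proof (intro iffI ballI allI impI)
    fix j s
    assume "\<forall>j. j + 1 \<in> M \<longrightarrow> (\<forall>s\<in>S. orth (Susp T W) (shift T (j + 1) s))" "j \<in> M" "s \<in> S"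
    from this(1)[rule_format, of "j - 1" s] this(2,3) show "orth (Susp T W) (shift T j s)"
      by simp
  qed (rule bspec, erule bspec)
  thus ?thesis
    unfolding mem_left_perp_shifts_iff orth_Susp_shift_iff by simp
qed

lemma left_perp_isomorphic: "isomorphic T X Y \<Longrightarrow> X \<in> left_perp T M \<Longrightarrow> Y \<in> left_perp T M"
  unfolding left_perp_def using orth_isomorphic_left by blast

lemma T_le_mono: "i \<le> i' \<Longrightarrow> T_le T S i \<subseteq> T_le T S i'"
  unfolding T_le_def by (auto simp: mem_left_perp_shifts_iff)

lemma Susp_T_le_iff: "Susp T W \<in> T_le T S (i - 1) \<longleftrightarrow> W \<in> T_le T S i"
proof -
  have "{j. j + 1 \<in> {..<- (i - 1)}} = {..<- i}"
    by auto
  thus ?thesis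
    unfolding T_le_def Susp_left_perp_shifts_iff by simp
qed

lemma Susp_T_le: "W \<in> T_le T S i \<Longrightarrow> Susp T W \<in> T_le T S i"
  using Susp_T_le_iff[of W S i] T_le_mono[of "i - 1" i S] by auto

lemma desusp_T_le:
  assumes "W \<in> T_le T S i"
  shows "desusp T W \<in> T_le T S (i + 1)"
proof -
  have "Susp T (desusp T W) \<in> T_le T S i"
    using assms left_perp_isomorphic[OF isomorphic_sym[OF Susp_desusp]] unfolding T_le_def by blast
  thus ?thesis
    using Susp_T_le_iff[of "desusp T W" S "i + 1"] by simp
qed

text \<open>
  An object built from \<open>S\<close> in finitely many steps receives no maps from objects of \<open>T_le T S i\<close> when \<open>i\<close> is
  small: the objects with this property form a thick subcategory, which contains \<open>S\<close>.
\<close>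

lemma orth_T_le_left:
  assumes gen: "thick_subcategory T hull S = UNIV"
  shows "\<exists>i. \<forall>P\<in>T_le T S i. orth P W"
proof -
  define V where "V = {W. \<exists>i. \<forall>P\<in>T_le T S i. orth P W}"
  have VI: "W \<in> V" if "\<And>P. P \<in> T_le T S i \<Longrightarrow> orth P W" for W i
    using that unfolding V_def by blast
  have VE: "\<exists>i. \<forall>P\<in>T_le T S i. orth P W" if "W \<in> V" for W
    using that unfolding V_def by blast
  have Susp: "Susp T X \<in> V" if X: "X \<in> V" for X
  proof -
    obtain i where i: "\<forall>P\<in>T_le T S i. orth P X"
      using VE[OF X] ..
    show ?thesis
    \<comment> \<open>suspension moves the level at which maps vanish down by one\<close>
    proof (rule VI[of "i - 1"])
      fix P
      assume P: "P \<in> T_le T S (i - 1)"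
      have "desusp T P \<in> T_le T S i"
        using desusp_T_le[OF P] by simp
      hence "orth (desusp T P) X"
        by (rule i[rule_format])
      hence "orth (Susp T (desusp T P)) (Susp T X)"
        by (simp only: orth_Susp_iff)
      thus "orth P (Susp T X)"
        by (rule orth_isomorphic_left[OF Susp_desusp])
    qed
  qed
  have "thick_subcategory T V"
    unfolding thick_subcategory_def
  proof (intro conjI allI impI iffI)
    show "Z \<in> V" if "zero_object T Z" for Z
      using zero_object_orth(2)[OF that] by (rule VI)
    show "Susp T X \<in> V" if "X \<in> V" for X
      by (rule Susp[OF that])
    show "X \<in> V" if SX: "Susp T X \<in> V" for X
    proof -
      obtain i where i: "\<forall>P\<in>T_le T S i. orth P (Susp T X)"
        using VE[OF SX] ..
      show ?thesis
      proof (rule VI)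
        fix P
        assume "P \<in> T_le T S i"
        hence "orth (Susp T P) (Susp T X)"
          by (intro i[rule_format] Susp_T_le)
        thus "orth P X"
          by (simp only: orth_Susp_iff)
      qed
    qed
    show "Z \<in> V" if XY: "(X, Y, Z, f, g, h) \<in> Tri T \<and> X \<in> V \<and> Y \<in> V" for X Y Z f g h
    proof -
      obtain i where i: "\<forall>P\<in>T_le T S i. orth P (Susp T X)"
        using VE[OF Susp[OF conjunct1[OF conjunct2[OF XY]]]] ..
      obtain i' where i': "\<forall>P\<in>T_le T S i'. orth P Y"
        using VE[OF conjunct2[OF conjunct2[OF XY]]] ..
      show ?thesis
      proof (rule VI)
        fix P
        assume "P \<in> T_le T S (min i i')"
        hence "P \<in> T_le T S i" "P \<in> T_le T S i'"
          using T_le_mono[of "min i i'" i S] T_le_mono[of "min i i'" i' S] by auto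
        thus "orth P Z"
          by (intro cone_orth_right[OF conjunct1[OF XY]] i[rule_format] i'[rule_format])
      qed
    qed
    show "closed_under_summands T V"
      unfolding closed_under_summands_def
    proof (intro allI impI, elim conjE)
      fix X X' Y
      assume sum: "direct_sum2 T X X' Y" and Y: "Y \<in> V"
      obtain i where i: "\<forall>P\<in>T_le T S i. orth P Y"
        using VE[OF Y] ..
      obtain a b where ab: "a \<in> homs T X Y" "b \<in> homs T Y X" "b \<bullet> a = Idt T X"
        by (rule direct_sum2_retract[OF sum])
      show "X \<in> V"
        by (rule VI[of i], rule orth_retract_right[OF bspec[OF i] ab])
    qed
  qed
  moreover have "S \<subseteq> V"
  proof
    fix s
    assume s: "s \<in> S"
    have "orth P s" if "P \<in> T_le T S (-1)" for P
    proof -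
      have "\<forall>j\<in>{..<- (- 1)}. \<forall>s\<in>S. orth P (shift T j s)"
        using that unfolding T_le_def mem_left_perp_shifts_iff .
      from bspec[OF bspec[OF this, of 0] s] show ?thesis
        by (simp add: shift_def)
    qed
    thus "s \<in> V"
      by (rule VI)
  qed
  ultimately have "V = UNIV"
    using hull_minimal[of S V "thick_subcategory T"] gen by blast
  hence "W \<in> V"
    by simp
  thus ?thesis
    by (rule VE)
qed

end

sublocale SMC_quadruple \<subseteq> thick_in_triangulated K T Tp
  by unfold_locales (rule RS0_thick)

context SMC_quadruple
begin

text \<open>
  One space is isomorphic to the dual of the other.  From right to left this uses that a finite-dimensional
  space is zero as soon as its dual is.
\<close>

lemma orth_Serre_iff:
  assumes P: "P \<in> Tp"
  shows "orth P W \<longleftrightarrow> orth W (SS P)"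
proof -
  obtain \<eta> where "\<forall>X\<in>Tp. \<forall>Y. lin_iso K (dual K (Hom T X Y)) (Hom T Y (SS X)) (\<eta> X Y)"
    using RS1_duality unfolding relative_Serre_duality_def by blast
  hence bij: "bij_betw (\<eta> P W) (carrier (dual K (Hom T P W))) (homs T W (SS P))"
    using P unfolding lin_iso_def by blast
  note inj = bij_betw_imp_inj_on[OF bij] and surj = bij_betw_imp_surj_on[OF bij]
  note d0 = dual_zero_closed[OF field_K module_Hom, of P W]
  show ?thesis
  proof
    assume 0: "orth P W"
    have eq: "u = \<eta> P W \<zero>\<^bsub>dual K (Hom T P W)\<^esub>" if "u \<in> homs T W (SS P)" for u
    proof -
      have "u \<in> \<eta> P W ` carrier (dual K (Hom T P W))"
        unfolding surj by (rule that)
      then obtain \<phi> where \<phi>: "u = \<eta> P W \<phi>" "\<phi> \<in> carrier (dual K (Hom T P W))"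
        by (rule imageE)
      show ?thesis
        using \<phi>(1) dual_trivial[OF field_K module_Hom 0 \<phi>(2)] by simp
    qed
    show "orth W (SS P)"
      using eq eq[OF zero_mor_closed] by (intro orthI) simp
  next
    assume 0: "orth W (SS P)"
    obtain n where n: "has_dim K (Hom T P W) n"
      using RS0_Hom_finite unfolding Hom_finite_def by blast
    show "orth P W"
    proof (rule trivial_if_dual_trivial[OF field_K module_Hom n])
      fix \<phi>
      assume \<phi>: "\<phi> \<in> carrier (dual K (Hom T P W))"
      have "\<eta> P W \<phi> = \<eta> P W \<zero>\<^bsub>dual K (Hom T P W)\<^esub>"
        using orthD[OF 0 bij_betwE[OF bij, rule_format, OF \<phi>]]
          orthD[OF 0 bij_betwE[OF bij, rule_format, OF d0]] by simp
      thus "\<phi> = \<zero>\<^bsub>dual K (Hom T P W)\<^esub>"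
        by (rule inj_onD[OF inj _ \<phi> d0])
    qed
  qed
qed

lemma orth_SS_imp_orth:
  assumes "orth (SS X) (SS Y)"
  shows "orth X Y"
proof (rule orthI)
  fix u
  assume u: "u \<in> homs T X Y"
  have bij: "bij_betw SSm (homs T X Y) (homs T (SS X) (SS Y))"
    using RS1_equivalence unfolding equivalence_on_def by blast
  have "SSm u = SSm (zero_mor X Y)"
    using orthD[OF assms bij_betwE[OF bij, rule_format, OF u]]
      orthD[OF assms bij_betwE[OF bij, rule_format, OF zero_mor_closed]] by simp
  thus "u = zero_mor X Y"
    by (rule inj_onD[OF bij_betw_imp_inj_on[OF bij] _ u zero_mor_closed])
qed

lemma generated: "thick_subcategory T hull S = UNIV"
  using RS2_SMC unfolding SMC_def by blast

text \<open>
  Serre duality turns maps into or out of a perfect object \<open>P\<close> around, which reduces the next two lemmas to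
  the thick induction above.
\<close>

lemma orth_perfect_right: "\<exists>i. \<forall>P\<in>T_le T S i. P \<in> Tp \<longrightarrow> orth Z P"
proof -
  obtain i where i: "\<forall>P\<in>T_le T S i. orth P (SS Z)"
    using orth_T_le_left[OF generated] ..
  have "orth Z P" if "P \<in> Tp" "P \<in> T_le T S i" for P
    using i[rule_format, OF that(2)] unfolding orth_Serre_iff[OF that(1)] by (rule orth_SS_imp_orth)
  thus ?thesis
    by (intro exI[of _ i] ballI impI)
qed

lemma orth_perfect_left:
  assumes "P \<in> Tp"
  shows "\<exists>i. \<forall>W\<in>T_le T S i. orth P W"
proof -
  obtain i where i: "\<forall>W\<in>T_le T S i. orth W (SS P)"
    using orth_T_le_left[OF generated] ..
  have "orth P W" if "W \<in> T_le T S i" for W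
    using i[rule_format, OF that] unfolding orth_Serre_iff[OF assms] .
  thus ?thesis
    by (intro exI[of _ i] ballI)
qed

text \<open>
  After \<open>n\<close> desuspensions an object of this perpendicular category lies in the left half of the
  co-t-structure, whose objects are perfect.
\<close>

lemma left_perp_shifts_perfect: "W \<in> left_perp T (shifts T {int n..} S) \<Longrightarrow> W \<in> Tp"
proof (induction n arbitrary: W)
  case 0
  thus ?case
    using RS2_left_sub by auto
next
  case (Suc n)
  have "Susp T (desusp T W) \<in> left_perp T (shifts T {int (Suc n)..} S)"
    using left_perp_isomorphic[OF isomorphic_sym[OF Susp_desusp] Suc.prems] .
  moreover have "{j. j + 1 \<in> {int (Suc n)..}} = {int n..}"
    by auto
  ultimately have "desusp T W \<in> Tp"
    using Suc.IH by (simp only: Susp_left_perp_shifts_iff)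
  thus ?case
    using thick_isomorphic[OF Susp_desusp] thick_Susp_iff by blast
qed

lemma T_gt_perfect: "T_gt T S (- int n) \<subseteq> Tp"
proof -
  have "{- (- int n) - 1<..} = {int n..}"
    by auto
  thus ?thesis
    unfolding T_gt_def using left_perp_shifts_perfect by auto
qed

end

section \<open>Truncations\<close>

text \<open>
  Only the truncations at the integers \<open>- p\<close> enter the limits; they are indexed by the natural number \<open>p\<close>.
\<close>

locale truncated = SMC_quadruple K T Tp SS SSm S
  for K :: "('k, 'r) ring_scheme" and T :: "('k, 'o, 'm, 'z) tcat_scheme"
    and Tp :: "'o set" and SS :: "'o \<Rightarrow> 'o" and SSm :: "'m \<Rightarrow> 'm" and S :: "'o set" +
  fixes X :: 'o and R :: "('o, 'm) truncation"
  assumes truncation: "is_truncation T S X R"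
begin

abbreviation gt where "gt p \<equiv> tr_gt R (- int p)"
abbreviation le where "le p \<equiv> tr_le R (- int p)"
abbreviation f where "f p \<equiv> tr_f R (- int p)"
abbreviation g where "g p \<equiv> tr_g R (- int p)"
abbreviation h where "h p \<equiv> tr_h R (- int p)"
abbreviation \<alpha> where "\<alpha> p \<equiv> tr_alpha R (- int p)"
abbreviation \<xi> where "\<xi> p \<equiv> tr_xi R (- int p)"

lemma Suc_level: "- int p - 1 = - int (Suc p)"
  by simp

lemma gt_perfect: "gt p \<in> Tp"
  and le_T_le: "le p \<in> T_le T S (- int p)"
  and tri: "(gt p, X, le p, f p, g p, h p) \<in> Tri T"
  using truncation T_gt_perfect[of p] unfolding is_truncation_def tr_triangle_def by blast+

lemmas f_closed = tri_homs(1)[OF tri]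
  and g_closed = tri_homs(2)[OF tri]
  and h_closed = tri_homs(3)[OF tri]

lemma connecting_morphism:
  "triangle_morphism T (gt p, X, le p, f p, g p, h p)
    (gt (Suc p), X, le (Suc p), f (Suc p), g (Suc p), h (Suc p)) (\<alpha> p) (Idt T X) (\<xi> p)"
  using truncation unfolding is_truncation_def tr_triangle_def Suc_level[symmetric] by blast

lemma \<alpha>_closed: "\<alpha> p \<in> homs T (gt p) (gt (Suc p))"
  and \<xi>_closed: "\<xi> p \<in> homs T (le p) (le (Suc p))"
  and \<xi>_h: "SuspM T (\<alpha> p) \<bullet> h p = h (Suc p) \<bullet> \<xi> p"
  using connecting_morphism[of p] unfolding triangle_morphism_def by simp_all

lemma \<xi>_g: "\<xi> p \<bullet> g p = g (Suc p)"
  using connecting_morphism[of p] Cmp_Idt_right[OF g_closed[of "Suc p"]]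
  unfolding triangle_morphism_def by simp

lemma Susp_gt_perfect: "Susp T (gt p) \<in> Tp"
  by (simp only: thick_Susp_iff gt_perfect)

lemma g_quot_mors: "g p \<in> quot_mors T Tp X (le p)"
  using rotate[OF tri] Susp_gt_perfect by (rule quot_morsI)

text \<open>
  The cone of \<open>\<xi> p\<close> has two descriptions.  By the octahedral axiom for \<open>g (Suc p) = \<xi> p \<bullet> g p\<close> it is also the
  cone of a map between the perfect objects \<open>Susp T (gt p)\<close> and \<open>Susp T (gt (Suc p))\<close>; and as the cone of \<open>\<xi> p\<close>
  it inherits orthogonality from \<open>le (Suc p)\<close> and the suspension of \<open>le p\<close>.
\<close>

lemma \<xi>_triangle:
  obtains C j j' where "C \<in> Tp" "C \<in> T_le T S (- int p)" "(le p, le (Suc p), C, \<xi> p, j, j') \<in> Tri T"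
proof -
  obtain C j j' where C: "(le p, le (Suc p), C, \<xi> p, j, j') \<in> Tri T"
    using Tri_cone[OF \<xi>_closed] by blast
  note t' = rotate[OF tri, of "Suc p", folded \<xi>_g]
  obtain u v where "(Susp T (gt p), Susp T (gt (Suc p)), C, u, v, SuspM T (h p) \<bullet> j') \<in> Tri T"
    using octahedral[OF rotate[OF tri] C t'] by blast
  hence "C \<in> Tp"
    using thick_cone Susp_gt_perfect by blast
  moreover have "C \<in> T_le T S (- int p)"
  proof -
    have "le (Suc p) \<in> T_le T S (- int p)" "Susp T (le p) \<in> T_le T S (- int p)"
      using le_T_le[of "Suc p"] T_le_mono[of "- int (Suc p)" "- int p" S] Susp_T_le[OF le_T_le] by auto
    thus ?thesis
      unfolding T_le_def mem_left_perp_shifts_iff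
      by (intro ballI cone_orth_left[OF C]) (drule (1) bspec, drule (1) bspec, assumption)+
  qed
  ultimately show thesis
    using C by (rule that)
qed

lemma \<xi>_quot_mors: "\<xi> p \<in> quot_mors T Tp (le p) (le (Suc p))"
  by (rule \<xi>_triangle) (rule quot_morsI)

lemma le_T_le_eventually:
  assumes "nat (- i) \<le> p"
  shows "le p \<in> T_le T S i" "Susp T (le p) \<in> T_le T S i"
proof -
  have "- int p \<le> i"
    using assms by simp
  thus "le p \<in> T_le T S i"
    using le_T_le T_le_mono by blast
  thus "Susp T (le p) \<in> T_le T S i"
    by (rule Susp_T_le)
qed

text \<open>
  Stabilization: the cones of the maps \<open>\<xi> p\<close> are perfect and lie in \<open>T_le T S (- int p)\<close>, so a fixed object
  eventually has no maps to them.
\<close>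

lemma \<xi>_eventually_iso:
  "\<exists>p0. \<forall>p\<ge>p0. bij_betw (\<lambda>u. \<xi> p \<bullet> u) (homs T Y (le p)) (homs T Y (le (Suc p)))"
proof -
  obtain i where i: "\<forall>P\<in>T_le T S i. P \<in> Tp \<longrightarrow> orth Y P"
    using orth_perfect_right ..
  obtain i' where i': "\<forall>P\<in>T_le T S i'. P \<in> Tp \<longrightarrow> orth (Susp T Y) P"
    using orth_perfect_right ..
  have "bij_betw (\<lambda>u. \<xi> p \<bullet> u) (homs T Y (le p)) (homs T Y (le (Suc p)))"
    if p: "nat (- min i i') \<le> p" for p
  proof -
    obtain C j j' where C: "C \<in> Tp" "C \<in> T_le T S (- int p)"
      and t: "(le p, le (Suc p), C, \<xi> p, j, j') \<in> Tri T"
      by (rule \<xi>_triangle)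
    have "- int p \<le> i" "- int p \<le> i'"
      using p by simp_all
    hence "C \<in> T_le T S i" "C \<in> T_le T S i'"
      using C(2) T_le_mono by blast+
    thus ?thesis
      by (intro post_comp_bij[OF t] i[rule_format] i'[rule_format] C(1))
  qed
  thus ?thesis
    by blast
qed

text \<open>
  Maps that are inverted in the quotient become invisible to \<open>le p\<close> for large \<open>p\<close>: their cone \<open>C\<close> is perfect,
  hence has no maps to \<open>le p\<close> by Serre duality.
\<close>

lemma quot_mors_eventually_iso:
  assumes "s \<in> quot_mors T Tp V W"
  shows "\<exists>p0. \<forall>p\<ge>p0. bij_betw (\<lambda>u. u \<bullet> s) (homs T W (le p)) (homs T V (le p))"
proof -
  obtain C a b where C: "C \<in> Tp" "(V, W, C, s, a, b) \<in> Tri T"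
    using assms by (rule quot_morsE)
  obtain i where i: "\<forall>W\<in>T_le T S i. orth C W"
    using orth_perfect_left[OF C(1)] ..
  have "bij_betw (\<lambda>u. u \<bullet> s) (homs T W (le p)) (homs T V (le p))" if "nat (- i) \<le> p" for p
    by (intro pre_comp_bij[OF C(2)] i[rule_format] le_T_le_eventually[OF that])
  thus ?thesis
    by blast
qed

text \<open>
  The third object of the triangle starting with \<open>h p\<close> is the suspension of \<open>X\<close>, which does not depend on
  \<open>p\<close>; so one bound works for all \<open>p\<close>.
\<close>

lemma h_iso:
  "\<exists>i. \<forall>W\<in>T_le T S i. \<forall>p. bij_betw (\<lambda>u. h p \<bullet> u) (homs T W (le p)) (homs T W (Susp T (gt p)))"
proof -
  obtain i where i: "\<forall>P\<in>T_le T S i. orth P (Susp T X)"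
    using orth_T_le_left[OF generated] ..
  have "bij_betw (\<lambda>u. h p \<bullet> u) (homs T W (le p)) (homs T W (Susp T (gt p)))"
    if "W \<in> T_le T S i" for W p
    by (intro post_comp_bij[OF rotate[OF rotate[OF tri]]] i[rule_format] Susp_T_le that)
  thus ?thesis
    by blast
qed

lemma direct_system_le: "direct_system K (\<lambda>p. Hom T Y (le p)) (\<lambda>p u. \<xi> p \<bullet> u)"
  by (rule direct_system.intro) (rule module_Hom, rule Cmp_lin_right[OF \<xi>_closed])

lemma direct_system_gt: "direct_system K (gt_sys T W R) (gt_trans T R)"
  unfolding gt_sys_def gt_trans_def
  by (rule direct_system.intro) (rule module_Hom, rule Cmp_lin_right[OF Susp_closed[OF \<alpha>_closed]])

end

section \<open>The Verdier quotient as a direct limit\<close>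

text \<open>
  The relation \<open>u \<bullet> s = g n \<bullet> a\<close> between a map \<open>u\<close> from \<open>Y\<close> to \<open>le n\<close> and a roof \<open>(Z, s, a)\<close> says that both
  describe the same map from \<open>Y\<close> to \<open>X\<close> in the quotient, where \<open>g n\<close> becomes invertible.  The locale shows
  that it matches the classes of the direct limit with the classes of roofs.
\<close>

locale truncated_target = truncated K T Tp SS SSm S X R
  for K :: "('k, 'r) ring_scheme" and T :: "('k, 'o, 'm, 'z) tcat_scheme"
    and Tp :: "'o set" and SS :: "'o \<Rightarrow> 'o" and SSm :: "'m \<Rightarrow> 'm" and S :: "'o set"
    and X :: 'o and R :: "('o, 'm) truncation" +
  fixes Y :: 'o
begin

abbreviation tr where "tr p u \<equiv> \<xi> p \<bullet> u"

sublocale dir: direct_system K "\<lambda>p. Hom T Y (le p)" tr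
  by (rule direct_system_le)

definition represents :: "nat \<Rightarrow> 'm \<Rightarrow> 'o \<times> 'm \<times> 'm \<Rightarrow> bool" where
  "represents n u r \<longleftrightarrow> (case r of (Z, s, a) \<Rightarrow>
    u \<in> homs T Y (le n) \<and> (Z, s, a) \<in> roofs T Tp Y X \<and> u \<bullet> s = g n \<bullet> a)"

lemma roofE:
  assumes "(Z, s, a) \<in> roofs T Tp Y X"
  obtains "s \<in> quot_mors T Tp Z Y" "s \<in> homs T Z Y" "a \<in> homs T Z X"
  using assms unfolding roofs_def by (auto elim: quot_morsE)

lemma roofI: "s \<in> quot_mors T Tp Z Y \<Longrightarrow> a \<in> homs T Z X \<Longrightarrow> (Z, s, a) \<in> roofs T Tp Y X"
  unfolding roofs_def by simp

lemma representsI: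
  assumes "u \<in> homs T Y (le n)" "s \<in> quot_mors T Tp Z Y" "a \<in> homs T Z X" "u \<bullet> s = g n \<bullet> a"
  shows "represents n u (Z, s, a)"
  using assms roofI unfolding represents_def by simp

lemma representsE:
  assumes "represents n u (Z, s, a)"
  obtains "u \<in> homs T Y (le n)" "s \<in> quot_mors T Tp Z Y" "s \<in> homs T Z Y" "a \<in> homs T Z X"
    "u \<bullet> s = g n \<bullet> a"
  using assms unfolding represents_def by (auto elim: roofE)

lemma represents_roof: "represents n u r \<Longrightarrow> r \<in> roofs T Tp Y X"
  unfolding represents_def by auto

lemma represents_closed: "represents n u r \<Longrightarrow> u \<in> homs T Y (le n)"
  unfolding represents_def by auto

lemma represents_push: "represents n u r \<Longrightarrow> represents (n + j) (dl_push tr n j u) r"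
proof (induction j)
  case (Suc j)
  obtain Z s a where r: "r = (Z, s, a)"
    by (cases r)
  let ?u = "dl_push tr n j u"
  from Suc have "represents (n + j) ?u (Z, s, a)"
    unfolding r by simp
  then obtain u: "?u \<in> homs T Y (le (n + j))" and s: "s \<in> quot_mors T Tp Z Y" "s \<in> homs T Z Y"
    and a: "a \<in> homs T Z X" and eq: "?u \<bullet> s = g (n + j) \<bullet> a"
    by (rule representsE)
  have "(\<xi> (n + j) \<bullet> ?u) \<bullet> s = \<xi> (n + j) \<bullet> (g (n + j) \<bullet> a)"
    using Cmp_assoc[OF s(2) u \<xi>_closed] eq by simp
  also have "\<dots> = g (Suc (n + j)) \<bullet> a"
    using Cmp_assoc[OF a g_closed \<xi>_closed, of "n + j"] \<xi>_g[of "n + j"] by simp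
  finally have "represents (Suc (n + j)) (\<xi> (n + j) \<bullet> ?u) (Z, s, a)"
    by (intro representsI s(1) a Cmp_closed[OF u \<xi>_closed])
  thus ?case
    unfolding r by simp
qed simp

lemma represents_push_to: "represents n u r \<Longrightarrow> n + j = k \<Longrightarrow> represents k (dl_push tr n j u) r"
  using represents_push by blast

lemma represents_refine:
  assumes "represents n u (Z, s, a)" "c \<in> homs T W Z" "s \<bullet> c \<in> quot_mors T Tp W Y"
  shows "represents n u (W, s \<bullet> c, a \<bullet> c)"
proof -
  obtain u: "u \<in> homs T Y (le n)" and s: "s \<in> homs T Z Y" and a: "a \<in> homs T Z X"
    and eq: "u \<bullet> s = g n \<bullet> a"
    using assms(1) by (rule representsE)
  have "u \<bullet> (s \<bullet> c) = g n \<bullet> (a \<bullet> c)"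
    using Cmp_assoc[OF assms(2) s u] Cmp_assoc[OF assms(2) a g_closed] eq by simp
  thus ?thesis
    by (intro representsI u assms(3) Cmp_closed[OF assms(2) a])
qed

text \<open>
  Pull \<open>u\<close> back along \<open>g n\<close>: on the cocone of \<open>h n \<bullet> u\<close>, whose cone is perfect, \<open>u\<close> lifts along \<open>g n\<close>.
\<close>

lemma represents_ex_roof:
  assumes u: "u \<in> homs T Y (le n)"
  shows "\<exists>r. represents n u r"
proof -
  obtain Z s where s: "s \<in> quot_mors T Tp Z Y" "(h n \<bullet> u) \<bullet> s = zero_mor Z (Susp T (gt n))"
    using quot_mors_kill[OF Cmp_closed[OF u h_closed] Susp_gt_perfect] .
  have s': "s \<in> homs T Z Y"
    using s(1) by (rule quot_morsE)
  have "h n \<bullet> (u \<bullet> s) = zero_mor Z (Susp T (gt n))"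
    using Cmp_assoc[OF s' u h_closed] s(2) by simp
  then obtain a where "a \<in> homs T Z X" "u \<bullet> s = g n \<bullet> a"
    by (rule tri_weak_kernel[OF rotate[OF tri] Cmp_closed[OF s' u]])
  hence "represents n u (Z, s, a)"
    by (intro representsI u s(1))
  thus ?thesis ..
qed

text \<open>
  The map \<open>g n \<bullet> a\<close> extends uniquely along the denominator \<open>s\<close> when \<open>n\<close> is large; uniqueness gives the lemma
  after this one.
\<close>

lemma represents_ex_map:
  assumes r: "r \<in> roofs T Tp Y X"
  shows "\<exists>n u. represents n u r"
proof -
  obtain Z s a where r': "r = (Z, s, a)"
    by (cases r)
  obtain s: "s \<in> quot_mors T Tp Z Y" and a: "a \<in> homs T Z X"
    using r unfolding r' by (rule roofE)
  obtain n where "\<forall>p\<ge>n. bij_betw (\<lambda>u. u \<bullet> s) (homs T Y (le p)) (homs T Z (le p))"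
    using quot_mors_eventually_iso[OF s] ..
  hence "bij_betw (\<lambda>u. u \<bullet> s) (homs T Y (le n)) (homs T Z (le n))"
    by simp
  hence "g n \<bullet> a \<in> (\<lambda>u. u \<bullet> s) ` homs T Y (le n)"
    unfolding bij_betw_def using Cmp_closed[OF a g_closed] by simp
  then obtain u where "g n \<bullet> a = u \<bullet> s" "u \<in> homs T Y (le n)"
    by (rule imageE)
  hence "represents n u r"
    unfolding r' by (intro representsI s a) simp_all
  thus ?thesis
    by blast
qed

lemma represents_unique_map:
  assumes "represents n u r" "represents m v r"
  shows "dir.cls n u = dir.cls m v"
proof -
  obtain Z s a where r: "r = (Z, s, a)"
    by (cases r)
  have s: "s \<in> quot_mors T Tp Z Y"
    using assms(1) unfolding r by (rule representsE)
  obtain l where "\<forall>p\<ge>l. bij_betw (\<lambda>u. u \<bullet> s) (homs T Y (le p)) (homs T Z (le p))"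
    using quot_mors_eventually_iso[OF s] ..
  hence "bij_betw (\<lambda>u. u \<bullet> s) (homs T Y (le (n + (m + l)))) (homs T Z (le (n + (m + l))))"
    by (elim allE[of _ "n + (m + l)"]) simp
  hence inj: "inj_on (\<lambda>u. u \<bullet> s) (homs T Y (le (n + (m + l))))"
    by (rule bij_betw_imp_inj_on)
  let ?u = "dl_push tr n (m + l) u" and ?v = "dl_push tr m (n + l) v"
  have "represents (n + (m + l)) ?u (Z, s, a)"
    using represents_push[OF assms(1)] unfolding r .
  moreover have "represents (n + (m + l)) ?v (Z, s, a)"
    by (rule represents_push_to[OF assms(2)[unfolded r]]) simp
  ultimately have "?u \<bullet> s = ?v \<bullet> s" "?u \<in> homs T Y (le (n + (m + l)))" "?v \<in> homs T Y (le (n + (m + l)))"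
    by (auto elim!: representsE)
  hence "?u = ?v"
    using inj_onD[OF inj] by simp
  hence "((n, u), (m, v)) \<in> dl_rel (\<lambda>p. Hom T Y (le p)) tr"
    using represents_closed[OF assms(1)] represents_closed[OF assms(2)]
    by (intro dir.dl_relI[where i = "m + l" and j = "n + l"]) simp_all
  thus ?thesis
    by (rule equiv_class_eq[OF dir.equiv_dl_rel])
qed

text \<open>
  On a common denominator the difference of the numerators of two roofs that represent the same \<open>u\<close> is killed
  by \<open>g n\<close>, so it factors over the perfect object \<open>gt n\<close> and vanishes after a further refinement.
\<close>

lemma represents_unique_roof:
  assumes "represents n u r" "represents n u r'"
  shows "(r, r') \<in> roof_rel T Tp Y X"
proof -
  obtain Z s a where r: "r = (Z, s, a)"
    by (cases r)
  obtain Z' s' a' where r': "r' = (Z', s', a')"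
    by (cases r')
  obtain u: "u \<in> homs T Y (le n)" and s: "s \<in> quot_mors T Tp Z Y" "s \<in> homs T Z Y" and a: "a \<in> homs T Z X"
    and eq: "u \<bullet> s = g n \<bullet> a"
    using assms(1) unfolding r by (rule representsE)
  obtain s': "s' \<in> quot_mors T Tp Z' Y" "s' \<in> homs T Z' Y" and a': "a' \<in> homs T Z' X"
    and eq': "u \<bullet> s' = g n \<bullet> a'"
    using assms(2) unfolding r' by (rule representsE)
  obtain W c c' where c: "c \<in> homs T W Z" "c' \<in> homs T W Z'" "s \<bullet> c = s' \<bullet> c'"
    "s \<bullet> c \<in> quot_mors T Tp W Y"
    by (rule quot_mors_common_denominator[OF s(1) s'(1)])
  note ac = Cmp_closed[OF c(1) a] and ac' = Cmp_closed[OF c(2) a']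
  define d where "d = a \<bullet> c \<oplus>\<^bsub>Hom T W X\<^esub> \<ominus>\<^bsub>Hom T W X\<^esub> (a' \<bullet> c')"
  have d: "d \<in> homs T W X"
    unfolding d_def by (intro plus_closed neg_closed ac ac')
  have "g n \<bullet> (a \<bullet> c) = u \<bullet> (s \<bullet> c)"
    using Cmp_assoc[OF c(1) a g_closed] Cmp_assoc[OF c(1) s(2) u] eq by simp
  also have "\<dots> = g n \<bullet> (a' \<bullet> c')"
    using Cmp_assoc[OF c(2) a' g_closed] Cmp_assoc[OF c(2) s'(2) u] eq' c(3) by simp
  finally have "g n \<bullet> d = zero_mor W (le n)"
    unfolding d_def comp_plus_right[OF ac neg_closed[OF ac'] g_closed] comp_neg_right[OF ac' g_closed]
    using plus_neg_eq_zero_iff Cmp_closed[OF ac g_closed] Cmp_closed[OF ac' g_closed] by simp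
  then obtain w where w: "w \<in> homs T W (gt n)" "d = f n \<bullet> w"
    by (rule tri_weak_kernel[OF tri d])
  obtain V e where e: "e \<in> quot_mors T Tp V W" "w \<bullet> e = zero_mor V (gt n)"
    using quot_mors_kill[OF w(1) gt_perfect] .
  have e': "e \<in> homs T V W"
    using e(1) by (rule quot_morsE)
  have "d \<bullet> e = zero_mor V X"
    unfolding w(2) Cmp_assoc[OF e' w(1) f_closed] e(2) by (rule comp_zero_right[OF f_closed])
  hence "(a \<bullet> c) \<bullet> e \<oplus>\<^bsub>Hom T V X\<^esub> \<ominus>\<^bsub>Hom T V X\<^esub> ((a' \<bullet> c') \<bullet> e) = zero_mor V X"
    unfolding d_def comp_plus_left[OF e' ac neg_closed[OF ac']] comp_neg_left[OF e' ac'] .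
  hence "(a \<bullet> c) \<bullet> e = (a' \<bullet> c') \<bullet> e"
    using plus_neg_eq_zero_iff[OF Cmp_closed[OF e' ac] Cmp_closed[OF e' ac']] by simp
  hence "a \<bullet> (c \<bullet> e) = a' \<bullet> (c' \<bullet> e)"
    using Cmp_assoc[OF e' c(1) a] Cmp_assoc[OF e' c(2) a'] by simp
  moreover have se: "s \<bullet> (c \<bullet> e) = (s \<bullet> c) \<bullet> e"
    by (rule Cmp_assoc[OF e' c(1) s(2), symmetric])
  moreover have "s \<bullet> (c \<bullet> e) = s' \<bullet> (c' \<bullet> e)"
    unfolding se c(3) by (rule Cmp_assoc[OF e' c(2) s'(2)])
  moreover have "s \<bullet> (c \<bullet> e) \<in> quot_mors T Tp V Y"
    unfolding se by (rule quot_mors_comp[OF e(1) c(4)])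
  ultimately show ?thesis
    using represents_roof[OF assms(1)] represents_roof[OF assms(2)]
      Cmp_closed[OF e' c(1)] Cmp_closed[OF e' c(2)]
    unfolding r r' roof_rel_def by blast
qed

lemma roof_relE:
  assumes "(r, r') \<in> roof_rel T Tp Y X"
  obtains Z s a Z' s' a' W b b' where "r = (Z, s, a)" "r' = (Z', s', a')"
    "r \<in> roofs T Tp Y X" "r' \<in> roofs T Tp Y X" "b \<in> homs T W Z" "b' \<in> homs T W Z'"
    "s \<bullet> b \<in> quot_mors T Tp W Y" "s \<bullet> b = s' \<bullet> b'" "a \<bullet> b = a' \<bullet> b'"
  using assms unfolding roof_rel_def by blast

text \<open>
  A common refinement of two roofs represents both maps, and equal classes have a common image that both roofs
  represent.  In particular the relation between roofs is an equivalence relation, as the one of the direct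
  limit is.
\<close>

lemma roof_rel_iff:
  assumes r: "represents n u r" and r': "represents m v r'"
  shows "(r, r') \<in> roof_rel T Tp Y X \<longleftrightarrow> dir.cls n u = dir.cls m v"
proof
  assume "(r, r') \<in> roof_rel T Tp Y X"
  then obtain Z s a Z' s' a' W b b' where eq: "r = (Z, s, a)" "r' = (Z', s', a')"
    and b: "b \<in> homs T W Z" "b' \<in> homs T W Z'"
      "s \<bullet> b \<in> quot_mors T Tp W Y" "s \<bullet> b = s' \<bullet> b'" "a \<bullet> b = a' \<bullet> b'"
    by (rule roof_relE)
  have "represents n u (W, s \<bullet> b, a \<bullet> b)"
    by (rule represents_refine[OF r[unfolded eq] b(1,3)])
  moreover have "represents m v (W, s \<bullet> b, a \<bullet> b)"
    using represents_refine[OF r'[unfolded eq] b(2)] b(3-5) by simp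
  ultimately show "dir.cls n u = dir.cls m v"
    by (rule represents_unique_map)
next
  note cl = represents_closed[OF r] represents_closed[OF r']
  assume "dir.cls n u = dir.cls m v"
  hence "((n, u), (m, v)) \<in> dl_rel (\<lambda>p. Hom T Y (le p)) tr"
    using dir.cls_eq_iff[OF cl] by simp
  then obtain i j where ij: "n + i = m + j" "dl_push tr n i u = dl_push tr m j v"
    by (rule dir.dl_relE)
  have "represents (n + i) (dl_push tr n i u) r"
    by (rule represents_push[OF r])
  moreover have "represents (n + i) (dl_push tr n i u) r'"
    unfolding ij by (rule represents_push[OF r'])
  ultimately show "(r, r') \<in> roof_rel T Tp Y X"
    by (rule represents_unique_roof)
qed

definition roof_class :: "(nat \<times> 'm) set \<Rightarrow> ('o \<times> 'm \<times> 'm) set" where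
  "roof_class A = {r. \<exists>(n, u)\<in>A. represents n u r}"

lemma mem_roof_class: "r \<in> roof_class A \<longleftrightarrow> (\<exists>n u. (n, u) \<in> A \<and> represents n u r)"
  unfolding roof_class_def by auto

lemma roof_class_cls:
  assumes r: "represents n u r"
  shows "roof_class (dir.cls n u) = roof_rel T Tp Y X `` {r}"
proof (intro equalityI subsetI)
  fix r'
  assume "r' \<in> roof_class (dir.cls n u)"
  then obtain m v where mv: "(m, v) \<in> dir.cls n u" and v: "represents m v r'"
    unfolding mem_roof_class by (elim exE conjE)
  have "(r, r') \<in> roof_rel T Tp Y X"
    unfolding roof_rel_iff[OF r v] by (rule dir.mem_cls(3)[OF mv, symmetric])
  thus "r' \<in> roof_rel T Tp Y X `` {r}"
    by simp
next
  fix r'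
  assume "r' \<in> roof_rel T Tp Y X `` {r}"
  hence rr': "(r, r') \<in> roof_rel T Tp Y X"
    by simp
  hence "r' \<in> roofs T Tp Y X"
    by (rule roof_relE)
  from represents_ex_map[OF this] obtain m v where v: "represents m v r'"
    by (elim exE)
  have "dir.cls n u = dir.cls m v"
    using rr' unfolding roof_rel_iff[OF r v] .
  hence "(m, v) \<in> dir.cls n u"
    using dir.cls_self[OF represents_closed[OF v]] by simp
  thus "r' \<in> roof_class (dir.cls n u)"
    unfolding mem_roof_class using v by (intro exI conjI)
qed

lemma mem_roof_class_cls:
  assumes "r \<in> roof_class (dir.cls n u)"
  obtains m v where "represents m v r" "dir.cls m v = dir.cls n u"
proof -
  obtain m v where "(m, v) \<in> dir.cls n u" "represents m v r"
    using assms unfolding mem_roof_class by (elim exE conjE)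
  thus thesis
    using that dir.mem_cls(3) by blast
qed

lemma represents_plus:
  assumes "represents m v (Z, s, a)" "represents k w (Z, s, b)"
  shows "represents (m + k) (dl_push tr m k v \<oplus>\<^bsub>Hom T Y (le (m + k))\<^esub> dl_push tr k m w)
    (Z, s, a \<oplus>\<^bsub>Hom T Z X\<^esub> b)"
proof -
  let ?v = "dl_push tr m k v" and ?w = "dl_push tr k m w"
  obtain v: "?v \<in> homs T Y (le (m + k))" and s: "s \<in> quot_mors T Tp Z Y" "s \<in> homs T Z Y"
    and a: "a \<in> homs T Z X" and eqv: "?v \<bullet> s = g (m + k) \<bullet> a"
    using represents_push[OF assms(1), of k] by (rule representsE)
  obtain w: "?w \<in> homs T Y (le (m + k))" and b: "b \<in> homs T Z X" and eqw: "?w \<bullet> s = g (m + k) \<bullet> b"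
    using represents_push_to[OF assms(2) add.commute] by (rule representsE)
  show ?thesis
    by (intro representsI plus_closed v w s(1) a b)
      (simp only: comp_plus_left[OF s(2) v w] comp_plus_right[OF a b g_closed] eqv eqw)
qed

lemma represents_scale:
  assumes c: "c \<in> carrier K" and "represents m v (Z, s, a)"
  shows "represents m (c \<odot>\<^bsub>Hom T Y (le m)\<^esub> v) (Z, s, c \<odot>\<^bsub>Hom T Z X\<^esub> a)"
proof -
  obtain v: "v \<in> homs T Y (le m)" and s: "s \<in> quot_mors T Tp Z Y" "s \<in> homs T Z Y"
    and a: "a \<in> homs T Z X" and eqv: "v \<bullet> s = g m \<bullet> a"
    using assms(2) by (rule representsE)
  show ?thesis
    by (intro representsI scale_closed c v s(1) a)
      (simp only: comp_scale_left[OF s(2) v c] comp_scale_right[OF a g_closed c] eqv)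
qed

text \<open>
  Sums of classes of roofs are formed on a common denominator, so both maps are first represented by roofs
  with the same \<open>s\<close>.
\<close>

lemma roof_class_add:
  assumes u: "u \<in> homs T Y (le n)" and v: "v \<in> homs T Y (le n)"
  shows "roof_class (dir.cls n (u \<oplus>\<^bsub>Hom T Y (le n)\<^esub> v))
    = roof_class (dir.cls n u) \<oplus>\<^bsub>quot_Hom T Tp Y X\<^esub> roof_class (dir.cls n v)"
proof -
  let ?sum = "roof_class (dir.cls n (u \<oplus>\<^bsub>Hom T Y (le n)\<^esub> v))"
  let ?F = "{roof_rel T Tp Y X `` {(Z, s, a \<oplus>\<^bsub>Hom T Z X\<^esub> b)} | Z s a b.
    (Z, s, a) \<in> roof_class (dir.cls n u) \<and> (Z, s, b) \<in> roof_class (dir.cls n v)}"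
  have eq: "roof_rel T Tp Y X `` {(Z, s, a \<oplus>\<^bsub>Hom T Z X\<^esub> b)} = ?sum"
    if ab: "(Z, s, a) \<in> roof_class (dir.cls n u)" "(Z, s, b) \<in> roof_class (dir.cls n v)" for Z s a b
  proof -
    obtain m u' where u': "represents m u' (Z, s, a)" "dir.cls m u' = dir.cls n u"
      by (rule mem_roof_class_cls[OF ab(1)])
    obtain k v' where v': "represents k v' (Z, s, b)" "dir.cls k v' = dir.cls n v"
      by (rule mem_roof_class_cls[OF ab(2)])
    note cl = represents_closed[OF u'(1)] represents_closed[OF v'(1)]
    show ?thesis
      unfolding dir.dlim_add[OF u v, symmetric] u'(2)[symmetric] v'(2)[symmetric]
        dir.dlim_add_general[OF cl]
      by (rule roof_class_cls[OF represents_plus[OF u'(1) v'(1)], symmetric])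
  qed
  obtain r where r: "represents n u r"
    using represents_ex_roof[OF u] ..
  obtain r' where r': "represents n v r'"
    using represents_ex_roof[OF v] ..
  obtain Z s a where rr: "r = (Z, s, a)"
    by (cases r)
  obtain Z' s' a' where rr': "r' = (Z', s', a')"
    by (cases r')
  have s: "s \<in> quot_mors T Tp Z Y"
    using r unfolding rr by (rule representsE)
  have s': "s' \<in> quot_mors T Tp Z' Y"
    using r' unfolding rr' by (rule representsE)
  obtain W c c' where c: "c \<in> homs T W Z" "c' \<in> homs T W Z'" "s \<bullet> c = s' \<bullet> c'"
    "s \<bullet> c \<in> quot_mors T Tp W Y"
    by (rule quot_mors_common_denominator[OF s s'])
  have "represents n u (W, s \<bullet> c, a \<bullet> c)"
    by (rule represents_refine[OF r[unfolded rr] c(1,4)])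
  hence m1: "(W, s \<bullet> c, a \<bullet> c) \<in> roof_class (dir.cls n u)"
    unfolding mem_roof_class using dir.cls_self[OF u] by (intro exI conjI)
  have "represents n v (W, s \<bullet> c, a' \<bullet> c')"
    using represents_refine[OF r'[unfolded rr'] c(2)] c(3,4) by simp
  hence m2: "(W, s \<bullet> c, a' \<bullet> c') \<in> roof_class (dir.cls n v)"
    unfolding mem_roof_class using dir.cls_self[OF v] by (intro exI conjI)
  have "?F = {?sum}"
  proof (intro equalityI subsetI)
    fix A
    assume "A \<in> ?F"
    then obtain Z s a b where "A = roof_rel T Tp Y X `` {(Z, s, a \<oplus>\<^bsub>Hom T Z X\<^esub> b)}"
      "(Z, s, a) \<in> roof_class (dir.cls n u)" "(Z, s, b) \<in> roof_class (dir.cls n v)"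
      by (elim CollectE exE conjE)
    thus "A \<in> {?sum}"
      using eq by simp
  next
    fix A
    assume "A \<in> {?sum}"
    hence "A = roof_rel T Tp Y X `` {(W, s \<bullet> c, a \<bullet> c \<oplus>\<^bsub>Hom T W X\<^esub> a' \<bullet> c')}"
      using eq[OF m1 m2] by simp
    thus "A \<in> ?F"
      using m1 m2 by (intro CollectI exI conjI)
  qed
  hence "\<Union>?F = ?sum"
    by simp
  thus ?thesis
    by (simp only: quot_Hom_def ring.simps)
qed

lemma roof_class_smult:
  assumes c: "c \<in> carrier K" and u: "u \<in> homs T Y (le n)"
  shows "roof_class (dir.cls n (c \<odot>\<^bsub>Hom T Y (le n)\<^esub> u))
    = c \<odot>\<^bsub>quot_Hom T Tp Y X\<^esub> roof_class (dir.cls n u)"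
proof -
  let ?cu = "roof_class (dir.cls n (c \<odot>\<^bsub>Hom T Y (le n)\<^esub> u))"
  have eq: "roof_rel T Tp Y X `` {(Z, s, c \<odot>\<^bsub>Hom T Z X\<^esub> a)} = ?cu"
    if a: "(Z, s, a) \<in> roof_class (dir.cls n u)" for Z s a
  proof -
    obtain m u' where u': "represents m u' (Z, s, a)" "dir.cls m u' = dir.cls n u"
      by (rule mem_roof_class_cls[OF a])
    show ?thesis
      unfolding dir.dlim_smult[OF c u, symmetric] u'(2)[symmetric]
        dir.dlim_smult[OF c represents_closed[OF u'(1)]]
      by (rule roof_class_cls[OF represents_scale[OF c u'(1)], symmetric])
  qed
  obtain r where r: "represents n u r"
    using represents_ex_roof[OF u] ..
  obtain Z s a where rr: "r = (Z, s, a)"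
    by (cases r)
  have m: "(Z, s, a) \<in> roof_class (dir.cls n u)"
    unfolding mem_roof_class using dir.cls_self[OF u] r[unfolded rr] by (intro exI conjI)
  have "(\<Union>(Z, s, a)\<in>roof_class (dir.cls n u). roof_rel T Tp Y X `` {(Z, s, c \<odot>\<^bsub>Hom T Z X\<^esub> a)}) = ?cu"
    by (rule UN_pair_eqI[OF m], clarify) (rule eq)
  thus ?thesis
    by (simp only: quot_Hom_def module.simps)
qed

lemma lin_iso_roof_class: "lin_iso K (colim_le T Y R) (quot_Hom T Tp Y X) roof_class"
proof -
  let ?A = "dlim (\<lambda>p. Hom T Y (le p)) tr"
  have carrier: "carrier (quot_Hom T Tp Y X) = roofs T Tp Y X // roof_rel T Tp Y X"
    by (simp add: quot_Hom_def)
  have lin: "lin_map K ?A (quot_Hom T Tp Y X) roof_class"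
  proof (rule dir.dlim_lin_mapI)
    fix n u
    assume "u \<in> homs T Y (le n)"
    from represents_ex_roof[OF this] obtain r where r: "represents n u r" ..
    show "roof_class (dir.cls n u) \<in> carrier (quot_Hom T Tp Y X)"
      unfolding carrier roof_class_cls[OF r] by (intro quotientI represents_roof[OF r])
  qed (rule roof_class_add roof_class_smult; assumption)+
  have inj: "inj_on roof_class (carrier ?A)"
  proof (rule inj_onI)
    fix A B
    assume A: "A \<in> carrier ?A" and B: "B \<in> carrier ?A" and eq: "roof_class A = roof_class B"
    obtain n u where u: "u \<in> homs T Y (le n)" "A = dir.cls n u"
      by (rule dir.dlim_cases[OF A])
    obtain m v where v: "v \<in> homs T Y (le m)" "B = dir.cls m v"
      by (rule dir.dlim_cases[OF B])
    obtain r where r: "represents n u r"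
      using represents_ex_roof[OF u(1)] ..
    have "r \<in> roof_class (dir.cls n u)"
      unfolding mem_roof_class using dir.cls_self[OF u(1)] r by (intro exI conjI)
    hence "r \<in> roof_class (dir.cls m v)"
      using eq u(2) v(2) by simp
    then obtain k w where "represents k w r" "dir.cls k w = dir.cls m v"
      by (rule mem_roof_class_cls)
    thus "A = B"
      using represents_unique_map[OF r] u(2) v(2) by simp
  qed
  have surj: "carrier (quot_Hom T Tp Y X) \<subseteq> roof_class ` carrier ?A"
  proof
    fix A
    assume "A \<in> carrier (quot_Hom T Tp Y X)"
    then obtain r where r: "A = roof_rel T Tp Y X `` {r}" "r \<in> roofs T Tp Y X"
      unfolding carrier by (rule quotientE)
    from represents_ex_map[OF r(2)] obtain n u where u: "represents n u r"
      by (elim exE)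
    show "A \<in> roof_class ` carrier ?A"
      using roof_class_cls[OF u] dir.cls_closed[OF represents_closed[OF u]] r(1)
      by (intro image_eqI[of _ _ "dir.cls n u"]) simp_all
  qed
  have "roof_class ` carrier ?A \<subseteq> carrier (quot_Hom T Tp Y X)"
    by (rule image_subsetI) (rule lin_map_closed[OF lin])
  thus ?thesis
    unfolding colim_le_def lin_iso_def bij_betw_def by (intro conjI lin inj equalityI surj)
qed

end

section \<open>The iterated limit\<close>

context truncated
begin

lemma colim_le_iso: "lin_isomorphic K (colim_le T Y R) (quot_Hom T Tp Y X)"
proof -
  interpret truncated_target K T Tp SS SSm S X R Y ..
  show ?thesis
    unfolding lin_isomorphic_def by (rule exI) (rule lin_iso_roof_class)
qed

lemma pre_comp_le_map:
  assumes "s \<in> homs T V W"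
  shows "direct_system_map K (\<lambda>p. Hom T W (le p)) (\<lambda>p u. \<xi> p \<bullet> u)
    (\<lambda>p. Hom T V (le p)) (\<lambda>p u. \<xi> p \<bullet> u) (\<lambda>p u. u \<bullet> s)"
proof (intro direct_system_map.intro direct_system_map_axioms.intro direct_system_le)
  show "lin_map K (Hom T W (le n)) (Hom T V (le n)) (\<lambda>u. u \<bullet> s)" for n
    by (rule Cmp_lin_left[OF assms])
  show "(\<xi> n \<bullet> v) \<bullet> s = \<xi> n \<bullet> (v \<bullet> s)" if "v \<in> homs T W (le n)" for v n
    by (rule Cmp_assoc[OF assms that \<xi>_closed])
qed

lemma pre_comp_gt_map:
  assumes "s \<in> homs T V W"
  shows "direct_system_map K (gt_sys T W R) (gt_trans T R) (gt_sys T V R) (gt_trans T R) (\<lambda>p u. u \<bullet> s)"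
proof (intro direct_system_map.intro direct_system_map_axioms.intro direct_system_gt)
  show "lin_map K (gt_sys T W R n) (gt_sys T V R n) (\<lambda>u. u \<bullet> s)" for n
    unfolding gt_sys_def by (rule Cmp_lin_left[OF assms])
  show "gt_trans T R n v \<bullet> s = gt_trans T R n (v \<bullet> s)" if "v \<in> carrier (gt_sys T W R n)" for v n
    using that unfolding gt_sys_def gt_trans_def
    by (rule Cmp_assoc[OF assms _ Susp_closed[OF \<alpha>_closed]])
qed

lemma post_comp_h_map:
  "direct_system_map K (\<lambda>p. Hom T W (le p)) (\<lambda>p u. \<xi> p \<bullet> u) (gt_sys T W R) (gt_trans T R) (\<lambda>p u. h p \<bullet> u)"
proof (intro direct_system_map.intro direct_system_map_axioms.intro direct_system_le direct_system_gt)
  show "lin_map K (Hom T W (le n)) (gt_sys T W R n) (\<lambda>u. h n \<bullet> u)" for n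
    unfolding gt_sys_def by (rule Cmp_lin_right[OF h_closed])
  show "h (Suc n) \<bullet> (\<xi> n \<bullet> v) = gt_trans T R n (h n \<bullet> v)" if v: "v \<in> homs T W (le n)" for v n
    unfolding gt_trans_def
    using Cmp_assoc[OF v \<xi>_closed h_closed] Cmp_assoc[OF v h_closed Susp_closed[OF \<alpha>_closed]] \<xi>_h[of n]
    by simp
qed

text \<open>
  Precomposition with \<open>s\<close> is eventually bijective on maps to \<open>le p\<close>, and the bijections given by \<open>h p\<close> carry
  this over to maps to \<open>Susp T (gt p)\<close>.
\<close>

lemma pre_comp_gt_eventually_iso:
  assumes s: "s \<in> quot_mors T Tp V W"
    and V: "\<And>p. bij_betw (\<lambda>u. h p \<bullet> u) (homs T V (le p)) (homs T V (Susp T (gt p)))"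
    and W: "\<And>p. bij_betw (\<lambda>u. h p \<bullet> u) (homs T W (le p)) (homs T W (Susp T (gt p)))"
  shows "\<exists>p0. \<forall>p\<ge>p0. bij_betw (\<lambda>u. u \<bullet> s) (homs T W (Susp T (gt p))) (homs T V (Susp T (gt p)))"
proof -
  have s': "s \<in> homs T V W"
    using s by (rule quot_morsE)
  obtain p0 where p0: "\<forall>p\<ge>p0. bij_betw (\<lambda>u. u \<bullet> s) (homs T W (le p)) (homs T V (le p))"
    using quot_mors_eventually_iso[OF s] ..
  have "bij_betw (\<lambda>u. u \<bullet> s) (homs T W (Susp T (gt p))) (homs T V (Susp T (gt p)))" if p: "p0 \<le> p" for p
  proof -
    have "bij_betw ((\<lambda>u. h p \<bullet> u) \<circ> (\<lambda>u. u \<bullet> s)) (homs T W (le p)) (homs T V (Susp T (gt p)))"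
      by (rule bij_betw_trans[OF p0[rule_format, OF p] V])
    hence "bij_betw ((\<lambda>u. u \<bullet> s) \<circ> (\<lambda>u. h p \<bullet> u)) (homs T W (le p)) (homs T V (Susp T (gt p)))"
      by (rule bij_betw_cong[THEN iffD1, rotated]) (simp add: Cmp_assoc[OF s' _ h_closed])
    thus ?thesis
      using bij_betw_comp_iff[OF W] by blast
  qed
  thus ?thesis
    by blast
qed

text \<open>
  The transition maps are bijective from \<open>q0\<close> on, so the limit is its entry at \<open>q0\<close>.  There \<open>h p\<close> identifies the
  direct limit with that of the spaces of maps from \<open>Y.le q0\<close> to \<open>le p\<close>, and precomposition with \<open>Y.g q0\<close>, which
  has a perfect cone, identifies the latter with the direct limit for \<open>Y\<close> itself.
\<close>

lemma lim_colim_iso: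
  assumes "is_truncation T S Y Q"
  shows "lin_isomorphic K (lim_colim T Q R) (quot_Hom T Tp Y X)"
proof -
  interpret Y: truncated K T Tp SS SSm S Y Q
    by unfold_locales (rule assms)
  interpret Yt: truncated_target K T Tp SS SSm S X R Y ..
  obtain i where i: "\<forall>W\<in>T_le T S i. \<forall>p. bij_betw (\<lambda>u. h p \<bullet> u) (homs T W (le p)) (homs T W (Susp T (gt p)))"
    using h_iso ..
  \<comment> \<open>from this level on, composition with \<open>h p\<close> is bijective on maps out of the truncations of \<open>Y\<close>\<close>
  define q0 where "q0 = nat (- i)"
  have h_bij: "bij_betw (\<lambda>u. h p \<bullet> u) (homs T (Y.le q) (le p)) (homs T (Y.le q) (Susp T (gt p)))"
    if "q0 \<le> q" for q p
    using i Y.le_T_le_eventually(1)[of i q] that unfolding q0_def by blast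
  let ?C = "\<lambda>q. dlim (gt_sys T (Y.le q) R) (gt_trans T R)"
  let ?t = "\<lambda>q. dlim_map (gt_sys T (Y.le q) R) (gt_trans T R) (\<lambda>p u. u \<bullet> Y.\<xi> q)"
  have proj: "lin_iso K (lim_colim T Q R) (?C q0) (\<lambda>x. x q0)"
    unfolding lim_colim_def
  proof (rule lin_iso_invlim_proj)
    show "?t q x \<in> carrier (?C q)" if "x \<in> carrier (?C (Suc q))" for q x
      by (rule lin_map_closed[OF direct_system_map.lin_map_dlim_map[OF pre_comp_gt_map[OF Y.\<xi>_closed]] that])
    show "bij_betw (?t q) (carrier (?C (Suc q))) (carrier (?C q))" if q: "q0 \<le> q" for q
    proof -
      have "\<exists>p0. \<forall>p\<ge>p0. bij_betw (\<lambda>u. u \<bullet> Y.\<xi> q) (homs T (Y.le (Suc q)) (Susp T (gt p)))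
          (homs T (Y.le q) (Susp T (gt p)))"
        using q by (intro pre_comp_gt_eventually_iso Y.\<xi>_quot_mors h_bij) simp_all
      then obtain p0 where p0: "\<forall>p\<ge>p0. bij_betw (\<lambda>u. u \<bullet> Y.\<xi> q)
          (homs T (Y.le (Suc q)) (Susp T (gt p))) (homs T (Y.le q) (Susp T (gt p)))" ..
      have "lin_iso K (?C (Suc q)) (?C q) (?t q)"
        by (rule direct_system_map.lin_iso_dlim_map[OF pre_comp_gt_map[OF Y.\<xi>_closed]])
          (unfold gt_sys_def, rule p0[rule_format])
      thus ?thesis
        by (simp add: lin_iso_def)
    qed
  qed
  let ?B = "dlim (\<lambda>p. Hom T (Y.le q0) (le p)) (\<lambda>p u. \<xi> p \<bullet> u)"
  let ?H = "dlim_map (gt_sys T (Y.le q0) R) (gt_trans T R) (\<lambda>p u. h p \<bullet> u)"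
  interpret B: direct_system K "\<lambda>p. Hom T (Y.le q0) (le p)" "\<lambda>p u. \<xi> p \<bullet> u"
    by (rule direct_system_le)
  have H: "lin_iso K ?B (?C q0) ?H"
    by (rule direct_system_map.lin_iso_dlim_map[OF post_comp_h_map])
      (unfold gt_sys_def, rule h_bij[OF order_refl])
  have H_inv: "lin_iso K (?C q0) ?B (inv_into (carrier ?B) ?H)"
    by (rule lin_iso_inv[OF H B.dlim_add_closed B.dlim_smult_closed])
  obtain p0 where p0: "\<forall>p\<ge>p0. bij_betw (\<lambda>u. u \<bullet> Y.g q0) (homs T (Y.le q0) (le p)) (homs T Y (le p))"
    using quot_mors_eventually_iso[OF Y.g_quot_mors] ..
  have G: "lin_iso K ?B (colim_le T Y R)
      (dlim_map (\<lambda>p. Hom T Y (le p)) (\<lambda>p u. \<xi> p \<bullet> u) (\<lambda>p u. u \<bullet> Y.g q0))"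
    unfolding colim_le_def
    by (rule direct_system_map.lin_iso_dlim_map[OF pre_comp_le_map[OF Y.g_closed]]) (rule p0[rule_format])
  show ?thesis
    unfolding lin_isomorphic_def
    by (rule exI, rule lin_iso_trans[OF lin_iso_trans[OF lin_iso_trans[OF proj H_inv] G] Yt.lin_iso_roof_class])
qed

end

theorem theoremA:
  fixes K :: "('k, 'r) ring_scheme" and T :: "('k, 'o, 'm, 'z) tcat_scheme"
    and Tp :: "'o set" and SS :: "'o \<Rightarrow> 'o" and SSm :: "'m \<Rightarrow> 'm" and S :: "'o set"
    and X Y :: 'o
  assumes "algebraically_closed K"
    and "SMC_quadruple K T Tp SS SSm S"
  shows "(\<forall>R. is_truncation T S X R \<longrightarrow>
      (\<exists>p0. \<forall>p\<ge>p0. lin_iso K (Hom T Y (tr_le R (- int p))) (Hom T Y (tr_le R (- int p - 1)))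
          (\<lambda>u. tr_xi R (- int p) \<cdot>\<^bsub>T\<^esub> u)) \<and>
      lin_isomorphic K (colim_le T Y R) (Hom (verdier_quotient T Tp) Y X)) \<and>
    (\<forall>Q R. is_truncation T S Y Q \<and> is_truncation T S X R \<longrightarrow>
      lin_isomorphic K (lim_colim T Q R) (Hom (verdier_quotient T Tp) Y X))"
proof (intro conjI allI impI)
  interpret SMC_quadruple K T Tp SS SSm S
    by (rule assms(2))
  have quot: "Hom (verdier_quotient T Tp) Y X = quot_Hom T Tp Y X"
    by (simp add: verdier_quotient_def)
  {
    fix R
    assume "is_truncation T S X R"
    then interpret truncated K T Tp SS SSm S X R
      by unfold_locales
    obtain p0 where "\<forall>p\<ge>p0. bij_betw (\<lambda>u. \<xi> p \<bullet> u) (homs T Y (le p)) (homs T Y (le (Suc p)))"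
      using \<xi>_eventually_iso ..
    hence "\<forall>p\<ge>p0. lin_iso K (Hom T Y (le p)) (Hom T Y (tr_le R (- int p - 1))) (\<lambda>u. \<xi> p \<bullet> u)"
      unfolding lin_iso_def Suc_level using Cmp_lin_right[OF \<xi>_closed] by blast
    thus "\<exists>p0. \<forall>p\<ge>p0. lin_iso K (Hom T Y (tr_le R (- int p))) (Hom T Y (tr_le R (- int p - 1)))
        (\<lambda>u. tr_xi R (- int p) \<cdot>\<^bsub>T\<^esub> u)" ..
    show "lin_isomorphic K (colim_le T Y R) (Hom (verdier_quotient T Tp) Y X)"
      unfolding quot by (rule colim_le_iso)
  }
  fix Q R
  assume "is_truncation T S Y Q \<and> is_truncation T S X R"
  hence Q: "is_truncation T S Y Q" and R: "is_truncation T S X R"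
    by simp_all
  interpret truncated K T Tp SS SSm S X R
    by unfold_locales (rule R)
  show "lin_isomorphic K (lim_colim T Q R) (Hom (verdier_quotient T Tp) Y X)"
    unfolding quot by (rule lim_colim_iso[OF Q])
qed

end
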